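(* Let $\mathbb{K}$ be a field, let $K_n$ be the complete graph on the vertex set $[n]=\{1,\dots,n\}$, and let $\mathbb{K}[K_n]$ be its edge ring, i.e. the second squarefree Veronese subring $\mathbb{K}[\{t_it_j\}_{1\le i<j\le n}]$ of the polynomial ring $\mathbb{K}[t_1,\dots,t_n]$. Let $\mathcal{F}_n$ be the family of connected chordal subgraphs of $K_n$ which satisfy the edge-distance condition. For each subgraph $H$ of $K_n$ let $I_H\subset\mathbb{K}[K_n]$ be the ideal generated by the elements $\bar{x}_{ij}=t_it_j$ with $\{i,j\}\in E(H)$, and let $$\mathcal{F}=\{I_H: H\in\mathcal{F}_n\}.$$ Then $\mathcal{F}$ is a Koszul filtration of $\mathbb{K}[K_n]$.
   Context: The ring $\mathbb{K}[K_n]$ is regarded as a standard graded $\mathbb{K}$-algebra in which each generator $t_it_j$ ($i<j$) has degree $1$; it is identified with $T/I_n$, where $T=\mathbb{K}[x_{ij}:\{i,j\}\in E(K_n)]$ (with $x_{ij}=x_{ji}$) and $I_n$ is the kernel of the map $T\to\mathbb{K}[K_n]$, $x_{ij}\mapsto t_it_j$; $\bar{x}_{ij}$ denotes the residue class of $x_{ij}$, corresponding to $t_it_j$. Koszul filtration: let $R$ be a standard graded algebra over a field $\mathbb{K}$ with graded maximal ideal $\mathfrak{m}$. A Koszul filtration of $R$ is a family $\mathcal{F}$ of ideals generated by linear forms (elements of degree $1$) such that (i) the zero ideal $(0)$ and $\mathfrak{m}$ belong to $\mathcal{F}$; (ii) for each $I\in\mathcal{F}$ with $I\neq 0$ there exists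 $J\in\mathcal{F}$ with $J\subset I$ such that $I/J$ is a cyclic module whose annihilator belongs to $\mathcal{F}$. Graphs: all graphs are finite and simple; subgraphs need not be induced. A graph is chordal if every cycle of length greater than $3$ in it has a chord. A graph $G$ satisfies the edge-distance condition if for any $\{i,j\},\{k,l\}\in E(G)$ with $\{i,j\}\cap\{k,l\}=\emptyset$, at least one of $\{i,k\},\{i,l\},\{j,k\},\{j,l\}$ belongs to $E(G)$. By convention the empty graph $\emptyset$ (no vertices, no edges) is regarded as connected and chordal and belongs to $\mathcal{F}_n$, with $I_\emptyset=(0)$. *)

theory Defs
  imports
    "HOL-Algebra.Module"
    "HOL-Algebra.Embedded_Algebras"
    "HOL-Algebra.Generated_Rings"
    "HOL-Algebra.QuotRing"
    "HOL-Algebra.Algebraic_Closure_Type"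
    "HOL-Library.Poly_Mapping"
begin

section \<open>Quotients of ideals as modules\<close>

text \<open>
  The module record of HOL-Algebra extends the ring record; its fields mult and one play no role for
  a module and are left unspecified.
\<close>

definition quotient_module :: "('a, 'b) ring_scheme \<Rightarrow> 'a set \<Rightarrow> 'a set \<Rightarrow> ('a, 'a set) module" where
  "quotient_module R I J =
     \<lparr>carrier = {J +>\<^bsub>R\<^esub> x | x. x \<in> I}, monoid.mult = undefined, one = undefined,
      ring.zero = J, add = set_add R,
      module.smult = (\<lambda>r A. \<Union>x\<in>A. J +>\<^bsub>R\<^esub> (r \<otimes>\<^bsub>R\<^esub> x))\<rparr>"

definition cyclic_module :: "('a, 'b) ring_scheme \<Rightarrow> ('a, 'c, 'd) module_scheme \<Rightarrow> bool" where
  "cyclic_module R M \<longleftrightarrow>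
     (\<exists>g\<in>carrier M. carrier M = {r \<odot>\<^bsub>M\<^esub> g | r. r \<in> carrier R})"

definition module_annihilator :: "('a, 'b) ring_scheme \<Rightarrow> ('a, 'c, 'd) module_scheme \<Rightarrow> 'a set" where
  "module_annihilator R M = {r \<in> carrier R. \<forall>m\<in>carrier M. r \<odot>\<^bsub>M\<^esub> m = \<zero>\<^bsub>M\<^esub>}"


section \<open>Standard graded algebras and Koszul filtrations\<close>

text \<open>
  The base field is embedded as a subfield \<open>K\<close> of \<open>R\<close> (a standard graded algebra has
  degree-zero part \<open>K\<close>). In HOL-Algebra, \<open>subalgebra K V R\<close> only says that \<open>V\<close> is a
  \<open>K\<close>-linear subspace of \<open>R\<close>.
\<close>

locale standard_graded_algebra = embedded_algebra K R + cring R
  for K :: "'a set" and R :: "('a, 'b) ring_scheme" (structure) +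
  fixes G :: "nat \<Rightarrow> 'a set"
  assumes graded_subspace: "subalgebra K (G d) R"
    and graded_decomposition: "x \<in> carrier R \<Longrightarrow>
      \<exists>!f. (\<forall>d. f d \<in> G d) \<and> finite {d. f d \<noteq> \<zero>} \<and> x = (\<Oplus>d\<in>{d. f d \<noteq> \<zero>}. f d)"
    and graded_mult: "x \<in> G c \<Longrightarrow> y \<in> G d \<Longrightarrow> x \<otimes> y \<in> G (c + d)"
    and degree_zero: "G 0 = K"
    and finite_dimension_degree_one: "finite_dimension K (G 1)"
    and generated_in_degree_one: "generate_ring R (K \<union> G 1) = carrier R"
begin

definition graded_maximal_ideal :: "'a set" where
  "graded_maximal_ideal = Idl (\<Union>d\<in>{1..}. G d)"

end

text \<open>
  Since the improper ideal is not generated by linear forms, an ideal \<open>J\<close> with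
  \<open>I / J = 0\<close> can never occur in the last axiom, so it does not matter whether the inclusion
  \<open>J \<subset> I\<close> is read as strict.
\<close>

locale koszul_filtration = standard_graded_algebra K R G
  for K :: "'a set" and R :: "('a, 'b) ring_scheme" (structure) and G :: "nat \<Rightarrow> 'a set" +
  fixes F :: "'a set set"
  assumes generated_by_linear_forms: "I \<in> F \<Longrightarrow> \<exists>S. S \<subseteq> G 1 \<and> I = Idl S"
    and zero_ideal_mem: "{\<zero>} \<in> F"
    and graded_maximal_ideal_mem: "graded_maximal_ideal \<in> F"
    and cyclic_step: "I \<in> F \<Longrightarrow> I \<noteq> {\<zero>} \<Longrightarrow>
      \<exists>J\<in>F. J \<subset> I \<and> cyclic_module R (quotient_module R I J)
             \<and> module_annihilator R (quotient_module R I J) \<in> F"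


section \<open>Graphs\<close>

text \<open>A simple graph is a pair of a vertex set and a set of edges, edges being two-element sets.\<close>

type_synonym 'v graph = "'v set \<times> 'v set set"

definition complete_graph :: "nat \<Rightarrow> nat graph" where
  "complete_graph n = ({1..n}, {{i, j} | i j. i \<in> {1..n} \<and> j \<in> {1..n} \<and> i < j})"

definition subgraph :: "'v graph \<Rightarrow> 'v graph \<Rightarrow> bool" where
  "subgraph H H' \<longleftrightarrow> fst H \<subseteq> fst H' \<and> snd H \<subseteq> snd H' \<and> (\<forall>e\<in>snd H. e \<subseteq> fst H)"

text \<open>The empty graph is connected.\<close>

definition connected_graph :: "'v graph \<Rightarrow> bool" where
  "connected_graph H \<longleftrightarrow> (\<forall>u\<in>fst H. \<forall>v\<in>fst H. (u, v) \<in> {(a, b). {a, b} \<in> snd H}\<^sup>*)"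

text \<open>A cycle is given by the list of its vertices in cyclic order.\<close>

definition cycle_edges :: "'v list \<Rightarrow> 'v set set" where
  "cycle_edges c = {{c ! i, c ! (Suc i mod length c)} | i. i < length c}"

definition is_cycle :: "'v graph \<Rightarrow> 'v list \<Rightarrow> bool" where
  "is_cycle H c \<longleftrightarrow>
     3 \<le> length c \<and> distinct c \<and> set c \<subseteq> fst H \<and> cycle_edges c \<subseteq> snd H"

definition has_chord :: "'v graph \<Rightarrow> 'v list \<Rightarrow> bool" where
  "has_chord H c \<longleftrightarrow> (\<exists>e\<in>snd H. e \<subseteq> set c \<and> e \<notin> cycle_edges c)"

definition chordal :: "'v graph \<Rightarrow> bool" where
  "chordal H \<longleftrightarrow> (\<forall>c. is_cycle H c \<and> length c > 3 \<longrightarrow> has_chord H c)"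

definition edge_distance_condition :: "'v graph \<Rightarrow> bool" where
  "edge_distance_condition H \<longleftrightarrow>
     (\<forall>i j k l. {i, j} \<in> snd H \<and> {k, l} \<in> snd H \<and> {i, j} \<inter> {k, l} = {} \<longrightarrow>
        {i, k} \<in> snd H \<or> {i, l} \<in> snd H \<or> {j, k} \<in> snd H \<or> {j, l} \<in> snd H)"

definition graph_family :: "nat \<Rightarrow> nat graph set" where
  "graph_family n = {H. subgraph H (complete_graph n) \<and> connected_graph H \<and> chordal H
                        \<and> edge_distance_condition H}"


section \<open>The edge ring of the complete graph\<close>

text \<open>
  Polynomials in variables indexed by natural numbers are finitely supported functions from
  exponent vectors to coefficients, with the convolution product.
\<close>

type_synonym 'k mpoly = "(nat \<Rightarrow>\<^sub>0 nat) \<Rightarrow>\<^sub>0 'k"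

definition poly_ring_upto :: "nat \<Rightarrow> ('k::field) mpoly ring" where
  "poly_ring_upto n =
     ring_of_type_algebra \<lparr>carrier := {p. \<forall>m\<in>Poly_Mapping.keys p. Poly_Mapping.keys m \<subseteq> {1..n}}\<rparr>"

definition constants :: "('k::field) mpoly set" where
  "constants = range (Poly_Mapping.single 0)"

text \<open>The monomial \<open>t_i t_j\<close>.\<close>

definition edge_monomial :: "nat \<Rightarrow> nat \<Rightarrow> ('k::field) mpoly" where
  "edge_monomial i j = Poly_Mapping.single (Poly_Mapping.single i 1 + Poly_Mapping.single j 1) 1"

definition edge_ring :: "nat \<Rightarrow> ('k::field) mpoly ring" where
  "edge_ring n = (poly_ring_upto n)
     \<lparr>carrier := generate_ring (poly_ring_upto n)
        (constants \<union> {edge_monomial i j | i j. i \<in> {1..n} \<and> j \<in> {1..n} \<and> i < j})\<rparr>"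

text \<open>
  The generators \<open>t_i t_j\<close> have degree 1 in the edge ring, so degree \<open>d\<close> in the edge ring is
  total degree \<open>2 * d\<close> in the polynomial ring.
\<close>

definition edge_ring_grading :: "nat \<Rightarrow> nat \<Rightarrow> ('k::field) mpoly set" where
  "edge_ring_grading n d =
     {p \<in> carrier (edge_ring n).
        \<forall>m\<in>Poly_Mapping.keys p. (\<Sum>i\<in>Poly_Mapping.keys m. Poly_Mapping.lookup m i) = 2 * d}"

definition edge_ideal :: "nat \<Rightarrow> nat graph \<Rightarrow> ('k::field) mpoly set" where
  "edge_ideal n H = genideal (edge_ring n) {edge_monomial i j | i j. {i, j} \<in> snd H}"

end

theory Submission
  imports Defs
begin

text \<open>
The idea is that the graph family consists, up to isolated vertices, exactly of the split graphs: those
with a clique \<open>C\<close> that meets every edge. Indeed the edge-distance condition excludes an induced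
\<open>2K\<^sub>2\<close>, chordality excludes induced cycles \<open>C\<^sub>4\<close> and \<open>C\<^sub>5\<close>, and these three
exclusions characterise split graphs (\<open>graph_family_imp_split\<close>). Conversely, split graphs are chordal and satisfy
the edge-distance condition, and they are connected once isolated vertices are dropped
(\<open>split_imp_graph_family\<close>).

Let \<open>E\<close> be the edge set of a split graph with at least one edge. The clique can be chosen so that some edge
\<open>ab\<close> joins it to the independent part (\<open>split_crossing_edge\<close>). Then \<open>E' = E - ab\<close> is
split again, and \<open>I\<^sub>E / I\<^sub>E\<^sub>'\<close> is generated by the class of \<open>t\<^sub>a t\<^sub>b\<close>. Its
annihilator is the colon ideal of \<open>I\<^sub>E\<^sub>'\<close> by \<open>t\<^sub>a t\<^sub>b\<close>. With \<open>N\<close> the set of neighbours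
of \<open>a\<close> in \<open>E'\<close>, this colon ideal turns out to be generated by the \<open>t\<^sub>k t\<^sub>l\<close> with \<open>k \<in> N\<close>, where
\<open>l = b\<close> is admitted only if \<open>kb\<close> is an edge of \<open>E'\<close> (\<open>split_colon\<close>). In that graph \<open>N\<close> is a clique
that meets every edge, so the annihilator belongs to the family.

All ideals involved are monomial, so the algebra reduces to exponent vectors. The edge ring is spanned by the
monomials of even degree \<open>2 d\<close> in which no exponent exceeds \<open>d\<close>: these are the products of edges, because
an edge between suitable vertices can always be split off
(\<open>exponents_split_edge_avoiding\<close>). The same splitting argument proves that the colon ideal is generated in
degree one and that the edges of the complete graph generate the graded maximal ideal.
\<close>

section \<open>Chordal graphs with the edge-distance condition are split graphs\<close>

text \<open>
These are the split graphs: \<open>C\<close> is a clique, and the vertices outside \<open>C\<close> are independent. Stating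
independence as ``every edge meets \<open>C\<close>'' makes the notion depend on the edge set alone, so isolated
vertices, which do not influence the edge ideal, never have to be tracked.
\<close>

definition split_by :: "'v set \<Rightarrow> 'v set set \<Rightarrow> bool" where
  "split_by C E \<longleftrightarrow> (\<forall>u\<in>C. \<forall>v\<in>C. u \<noteq> v \<longrightarrow> {u, v} \<in> E) \<and> (\<forall>e\<in>E. e \<inter> C \<noteq> {})"

lemma complete_graph_edges: "snd (complete_graph n) = {{i, j} | i j. i \<in> {1..n} \<and> j \<in> {1..n} \<and> i \<noteq> j}"
  (is "?L = ?R")
proof
  show "?L \<subseteq> ?R" unfolding complete_graph_def by force
  show "?R \<subseteq> ?L"
  proof
    fix e assume "e \<in> ?R"
    then obtain i j where ij: "e = {i, j}" "i \<in> {1..n}" "j \<in> {1..n}" "i \<noteq> j" by auto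
    show "e \<in> ?L"
    proof (cases "i < j")
      case True thus ?thesis using ij unfolding complete_graph_def snd_conv by blast
    next
      case False
      hence "j < i" "e = {j, i}" using ij by auto
      thus ?thesis using ij(2,3) unfolding complete_graph_def snd_conv by blast
    qed
  qed
qed

lemma complete_graph_edge_iff:
  "{u, v} \<in> snd (complete_graph n) \<longleftrightarrow> u \<noteq> v \<and> u \<in> {1..n} \<and> v \<in> {1..n}"
proof
  assume "{u, v} \<in> snd (complete_graph n)"
  then obtain i j where "{u, v} = {i, j}" "i \<in> {1..n}" "j \<in> {1..n}" "i \<noteq> j"
    unfolding complete_graph_edges by blast
  thus "u \<noteq> v \<and> u \<in> {1..n} \<and> v \<in> {1..n}" by (auto simp: doubleton_eq_iff)
next
  assume "u \<noteq> v \<and> u \<in> {1..n} \<and> v \<in> {1..n}"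
  thus "{u, v} \<in> snd (complete_graph n)" unfolding complete_graph_edges by blast
qed

lemma subgraph_complete_graph_edge:
  assumes "subgraph H (complete_graph n)" "{u, v} \<in> snd H"
  shows "u \<noteq> v" "u \<in> fst H" "v \<in> fst H" "u \<in> {1..n}" "v \<in> {1..n}"
proof -
  have "{u, v} \<in> snd (complete_graph n)" using assms unfolding subgraph_def by blast
  thus "u \<noteq> v" "u \<in> {1..n}" "v \<in> {1..n}" unfolding complete_graph_edge_iff by blast+
  show "u \<in> fst H" "v \<in> fst H" using assms unfolding subgraph_def by auto
qed

lemma cycle_edges_image: "cycle_edges c = (\<lambda>i. {c ! i, c ! (Suc i mod length c)}) ` {..<length c}"
  unfolding cycle_edges_def by blast

lemma chord_of_cycle:
  assumes sub: "subgraph H (complete_graph n)" and ch: "chordal H"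
    and c: "length c > 3" "distinct c" "cycle_edges c \<subseteq> snd H"
  obtains i j where "i \<in> set c" "j \<in> set c" "i \<noteq> j" "{i, j} \<in> snd H" "{i, j} \<notin> cycle_edges c"
proof -
  have "set c \<subseteq> \<Union>(cycle_edges c)"
  proof
    fix x assume "x \<in> set c"
    then obtain i where "i < length c" "x = c ! i" by (metis in_set_conv_nth)
    thus "x \<in> \<Union>(cycle_edges c)" unfolding cycle_edges_image by blast
  qed
  moreover have "\<Union>(cycle_edges c) \<subseteq> fst H" using sub c unfolding subgraph_def by blast
  ultimately have "is_cycle H c" using c unfolding is_cycle_def by (simp add: subset_trans)
  hence "has_chord H c" using ch c unfolding chordal_def by blast
  then obtain e where e: "e \<in> snd H" "e \<subseteq> set c" "e \<notin> cycle_edges c"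
    unfolding has_chord_def by auto
  have "e \<in> snd (complete_graph n)" using e(1) sub unfolding subgraph_def by blast
  then obtain i j where "e = {i, j}" "i \<noteq> j" unfolding complete_graph_edges by blast
  thus thesis using e that by auto
qed

lemma chordal_no_induced_4_cycle:
  assumes sub: "subgraph H (complete_graph n)" and ch: "chordal H"
    and E: "{p, q} \<in> snd H" "{q, r} \<in> snd H" "{r, s} \<in> snd H" "{s, p} \<in> snd H"
    and d: "p \<noteq> r" "q \<noteq> s"
  shows "{p, r} \<in> snd H \<or> {q, s} \<in> snd H"
proof -
  have ce: "cycle_edges [p, q, r, s] = {{p, q}, {q, r}, {r, s}, {s, p}}"
    unfolding cycle_edges_image by (simp add: lessThan_Suc) (simp add: insert_commute)
  have "distinct [p, q, r, s]"
    using subgraph_complete_graph_edge(1)[OF sub] E d by auto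
  then obtain i j where "i \<in> {p, q, r, s}" "j \<in> {p, q, r, s}" "i \<noteq> j" "{i, j} \<in> snd H"
    "{i, j} \<notin> {{p, q}, {q, r}, {r, s}, {s, p}}"
    using chord_of_cycle[OF sub ch, of "[p, q, r, s]"] E unfolding ce by auto
  thus ?thesis by (elim insertE emptyE; simp add: insert_commute)
qed

lemma chordal_no_induced_5_cycle:
  assumes sub: "subgraph H (complete_graph n)" and ch: "chordal H"
    and E: "{p, q} \<in> snd H" "{q, r} \<in> snd H" "{r, s} \<in> snd H" "{s, t} \<in> snd H" "{t, p} \<in> snd H"
    and d: "distinct [p, q, r, s, t]"
  shows "{p, r} \<in> snd H \<or> {p, s} \<in> snd H \<or> {q, s} \<in> snd H \<or> {q, t} \<in> snd H \<or> {r, t} \<in> snd H"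
proof -
  have ce: "cycle_edges [p, q, r, s, t] = {{p, q}, {q, r}, {r, s}, {s, t}, {t, p}}"
    unfolding cycle_edges_image by (simp add: lessThan_Suc) (simp add: insert_commute)
  obtain i j where "i \<in> {p, q, r, s, t}" "j \<in> {p, q, r, s, t}" "i \<noteq> j" "{i, j} \<in> snd H"
    "{i, j} \<notin> {{p, q}, {q, r}, {r, s}, {s, t}, {t, p}}"
    using chord_of_cycle[OF sub ch, of "[p, q, r, s, t]"] E d unfolding ce by auto
  thus ?thesis by (elim insertE emptyE; simp add: insert_commute)
qed

text \<open>
This is the nontrivial half of the theorem of Foeldes and Hammer: a graph without induced
\<open>2K\<^sub>2\<close>, \<open>C\<^sub>4\<close> and \<open>C\<^sub>5\<close> is split. A vertex \<open>v\<close> gets the weight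
\<open>card V + deg v\<close>, and \<open>C\<close> is a clique of maximal total weight. If an edge \<open>xy\<close> avoided \<open>C\<close>, absence of \<open>C\<^sub>4\<close>
would make the non-neighbours of \<open>x\<close> and of \<open>y\<close> in \<open>C\<close> nested, say those of \<open>x\<close> inside those of \<open>y\<close>,
and absence of \<open>2K\<^sub>2\<close> would leave \<open>x\<close> a single non-neighbour \<open>w\<close>. Exchanging \<open>w\<close> for \<open>x\<close> and \<open>y\<close>
would then increase the weight of \<open>C\<close> unless \<open>y\<close> has a second non-neighbour \<open>v\<close>; exchanging \<open>w\<close> for \<open>x\<close> alone
would increase it unless \<open>w\<close> has a neighbour \<open>z\<close> not adjacent to \<open>x\<close>. The vertices
\<open>w, z, y, x, v\<close> then produce an induced \<open>C\<^sub>4\<close> or \<open>C\<^sub>5\<close>.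
\<close>

lemma graph_family_imp_split:
  assumes H: "H \<in> graph_family n"
  shows "\<exists>C. split_by C (snd H)"
proof -
  define V where "V = fst H"
  define adj where "adj u v \<longleftrightarrow> {u, v} \<in> snd H" for u v
  have sub: "subgraph H (complete_graph n)" and ch: "chordal H" and ed: "edge_distance_condition H"
    using H unfolding graph_family_def by auto
  have finV: "finite V"
    using sub unfolding subgraph_def V_def complete_graph_def by (auto intro: finite_subset)
  have sym: "adj u v \<longleftrightarrow> adj v u" for u v unfolding adj_def by (simp add: insert_commute)
  have adjD: "u \<noteq> v" "u \<in> V" "v \<in> V" if "adj u v" for u v
    using subgraph_complete_graph_edge[OF sub] that unfolding adj_def V_def by auto
  have K2: "adj i k \<or> adj i l \<or> adj j k \<or> adj j l" 
    if "adj i j" "adj k l" "i \<noteq> k" "i \<noteq> l" "j \<noteq> k" "j \<noteq> l" for i j k l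
    using ed that unfolding edge_distance_condition_def adj_def by blast
  have C4: "adj p r \<or> adj q s" 
    if "adj p q" "adj q r" "adj r s" "adj s p" "p \<noteq> r" "q \<noteq> s" for p q r s
    using chordal_no_induced_4_cycle[OF sub ch] that unfolding adj_def by blast
  have C5: "adj p r \<or> adj p s \<or> adj q s \<or> adj q t \<or> adj r t"
    if "adj p q" "adj q r" "adj r s" "adj s t" "adj t p" "distinct [p, q, r, s, t]" for p q r s t
    using chordal_no_induced_5_cycle[OF sub ch] that unfolding adj_def by blast
  define clique where "clique C \<longleftrightarrow> C \<subseteq> V \<and> (\<forall>u\<in>C. \<forall>v\<in>C. u \<noteq> v \<longrightarrow> adj u v)" for C
  define nb where "nb u = {v. adj u v}" for u
  have finnb: "finite (nb u)" for u
  proof (rule finite_subset[OF _ finV])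
    show "nb u \<subseteq> V" using adjD(3) unfolding nb_def by blast
  qed
  \<comment> \<open>The summand \<open>card V\<close> bounds every degree, so replacing one vertex by two of positive
      degree increases the weight.\<close>
  define weight where "weight u = card V + card (nb u)" for u
  have weight_le: "card (nb u) \<le> card V" for u
  proof (rule card_mono[OF finV])
    show "nb u \<subseteq> V" using adjD(3) unfolding nb_def by blast
  qed
  have bound: "sum weight C \<le> sum weight V" if "clique C" for C
    using that finV unfolding clique_def by (intro sum_mono2) auto
  have "clique {}" unfolding clique_def by simp
  then obtain C where C: "clique C" and max: "\<And>D. clique D \<Longrightarrow> sum weight D \<le> sum weight C"
    using ex_has_greatest_nat[of clique "{}" "sum weight" "Suc (sum weight V)"] bound
    by (metis le_imp_less_Suc)
  have finC: "finite C" using C finV finite_subset unfolding clique_def by blast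
  have Cadj: "adj u v" if "u \<in> C" "v \<in> C" "u \<noteq> v" for u v
    using C that unfolding clique_def by auto
  have CV: "C \<subseteq> V" using C unfolding clique_def by auto
  have Vpos: "card V > 0" if "u \<in> V" for u using that finV card_gt_0_iff by blast
  have outside: "\<exists>w\<in>C. \<not> adj x w" if x: "x \<in> V" "x \<notin> C" for x
  proof (rule ccontr)
    assume "\<not> ?thesis"
    hence "clique (insert x C)" using x CV Cadj sym unfolding clique_def by blast
    from max[OF this] have "weight x = 0" using finC x by simp
    thus False using Vpos[OF x(1)] unfolding weight_def by simp
  qed
  have no_edge: False if xy: "adj x y" "x \<notin> C" "y \<notin> C"
    and le: "{w \<in> C. \<not> adj x w} \<subseteq> {w \<in> C. \<not> adj y w}" for x y
  proof -
    obtain w where w: "w \<in> C" "\<not> adj x w" using outside[of x] adjD[OF xy(1)] xy by auto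
    have yw: "\<not> adj y w" using le w by auto
    have unique: "v = w" if "v \<in> C" "\<not> adj x v" for v
    proof (rule ccontr)
      assume "v \<noteq> w"
      hence "adj v w" using Cadj that w by auto
      moreover have "\<not> adj y v" using le that by auto
      ultimately show False using K2[of v w x y] xy w yw that sym by metis
    qed
    have xC: "adj x v" if "v \<in> C" "v \<noteq> w" for v using unique that by blast
    have xV: "x \<in> V" "y \<in> V" "x \<noteq> y" "w \<in> V" "w \<noteq> x" "w \<noteq> y" using adjD[OF xy(1)] w CV xy by auto
    have split_sum: "sum weight C = weight w + sum weight (C - {w})"
      using finC w by (simp add: sum.remove)
    have cl1: "clique (insert x (C - {w}))"
      using xV CV Cadj xC sym unfolding clique_def by blast
    from max[OF cl1] have "weight x \<le> weight w" using finC xy split_sum by simp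
    hence card_le: "card (nb x) \<le> card (nb w)" unfolding weight_def by simp
    obtain v where v: "v \<in> C" "v \<noteq> w" "\<not> adj y v"
    proof (rule ccontr)
      assume "\<not> thesis"
      hence "\<forall>v\<in>C. v \<noteq> w \<longrightarrow> adj y v" using that by blast
      hence cl2: "clique (insert y (insert x (C - {w})))"
        using xV CV Cadj xC sym xy(1) unfolding clique_def by blast
      from max[OF cl2] have "weight y + weight x \<le> weight w" using finC xy xV split_sum by simp
      moreover have "card (nb x) > 0" using xy(1) finnb[of x] card_gt_0_iff unfolding nb_def by blast
      ultimately show False using weight_le[of w] unfolding weight_def by linarith
    qed
    have "\<not> nb w \<subseteq> nb x"
    proof
      assume "nb w \<subseteq> nb x"
      hence "nb w = nb x" using card_le finnb card_seteq by blast
      thus False using xy(1) yw sym unfolding nb_def by blast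
    qed
    then obtain z where z: "adj w z" "\<not> adj x z" unfolding nb_def by blast
    have zn: "z \<noteq> x" "z \<noteq> y" using z w yw sym by auto
    have zy: "adj z y" using K2[of z w x y] z xy xV zn w yw sym by blast
    have xv: "adj x v" using xC v by blast
    have vw: "adj v w" using Cadj v w by blast
    have vz: "v \<noteq> z" using xv z by auto
    have vd: "v \<noteq> x" "v \<noteq> y" using v xy by auto
    show False
    proof (cases "adj z v")
      case True
      thus False using C4[of z y x v] zy xy(1) xv z v vd zn vz sym by blast
    next
      case False
      have "distinct [w, z, y, x, v]" using adjD(1)[OF z(1)] zn vz vd v xV by auto
      thus False using C5[of w z y x v] z zy xy(1) xv vw w yw v False sym by blast
    qed
  qed
  have "e \<inter> C \<noteq> {}" if e: "e \<in> snd H" for e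
  proof
    assume disj: "e \<inter> C = {}"
    have "e \<in> snd (complete_graph n)" using e sub unfolding subgraph_def by blast
    then obtain x y where xy: "e = {x, y}" unfolding complete_graph_edges by blast
    have axy: "adj x y" "x \<notin> C" "y \<notin> C" using e xy disj unfolding adj_def by auto
    have "{w \<in> C. \<not> adj x w} \<subseteq> {w \<in> C. \<not> adj y w} \<or> {w \<in> C. \<not> adj y w} \<subseteq> {w \<in> C. \<not> adj x w}"
    proof (rule ccontr)
      assume "\<not> ?thesis"
      then obtain u v where uv: "u \<in> C" "\<not> adj x u" "adj y u" "v \<in> C" "\<not> adj y v" "adj x v" by blast
      hence "u \<noteq> v" by auto
      hence "adj u v" using uv Cadj by auto
      thus False using C4[of x y u v] uv axy sym by blast
    qed
    thus False using no_edge[of x y] no_edge[of y x] axy sym by blast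
  qed
  thus ?thesis using Cadj unfolding split_by_def adj_def by blast
qed

text \<open>
Deleting an edge keeps a graph split as long as the edge does not lie inside the clique. If all edges
lie inside \<open>C\<close>, one endpoint of an edge can be moved from the clique to the independent part.
\<close>

lemma split_crossing_edge:
  assumes E: "E \<subseteq> snd (complete_graph n)" "E \<noteq> {}" and sp: "split_by C E"
  obtains D a b where "split_by D E" "a \<in> D" "b \<notin> D" "{a, b} \<in> E"
proof (cases "\<exists>e\<in>E. \<not> e \<subseteq> C")
  case True
  then obtain e where e: "e \<in> E" "\<not> e \<subseteq> C" by blast
  then obtain i j where ij: "e = {i, j}" using E unfolding complete_graph_edges by blast
  have "e \<inter> C \<noteq> {}" using sp e unfolding split_by_def by blast
  hence "i \<in> C \<and> j \<notin> C \<or> j \<in> C \<and> i \<notin> C" using e ij by auto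
  thus thesis using that[OF sp] e ij by (metis insert_commute)
next
  case False
  obtain e where e: "e \<in> E" using E by blast
  then obtain i j where ij: "e = {i, j}" "i \<noteq> j" using E unfolding complete_graph_edges by blast
  have "f \<inter> (C - {j}) \<noteq> {}" if f: "f \<in> E" for f
  proof -
    obtain u v where "f = {u, v}" "u \<noteq> v" using f E unfolding complete_graph_edges by blast
    thus ?thesis using False f by auto
  qed
  hence "split_by (C - {j}) E" using sp unfolding split_by_def by blast
  thus thesis using that[of "C - {j}" i j] e ij False by auto
qed

text \<open>
For chordality: on a cycle, two vertices of the clique that are not consecutive span a chord. Of any
two consecutive vertices one lies in the clique, so already the positions \<open>m - 1, 0, 1, 2, 3\<close> of a
cycle of length \<open>m > 3\<close> contain two such vertices.
\<close>

lemma split_imp_graph_family: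
  assumes E: "E \<subseteq> snd (complete_graph n)" and sp: "split_by C E"
  shows "(\<Union>E, E) \<in> graph_family n"
proof -
  have clique: "{u, v} \<in> E" if "u \<in> C" "v \<in> C" "u \<noteq> v" for u v
    using sp that unfolding split_by_def by blast
  have meets: "u \<in> C \<or> v \<in> C" if "{u, v} \<in> E" for u v
  proof -
    have "{u, v} \<inter> C \<noteq> {}" using sp that unfolding split_by_def by (auto simp del: Int_insert_left)
    thus ?thesis by auto
  qed
  have "\<Union>E \<subseteq> fst (complete_graph n)" using E unfolding complete_graph_def by auto
  hence sub: "subgraph (\<Union>E, E) (complete_graph n)" using E unfolding subgraph_def by auto
  let ?R = "{(a, b). {a, b} \<in> E}"
  have to_C: "\<exists>c\<in>C. (u, c) \<in> ?R\<^sup>* \<and> (c, u) \<in> ?R\<^sup>*" if u: "u \<in> \<Union>E" for u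
  proof -
    obtain e where e: "e \<in> E" "u \<in> e" using u by blast
    then obtain i j where "e = {i, j}" using E unfolding complete_graph_edges by blast
    then obtain w where w: "{u, w} \<in> E" "{w, u} \<in> E" using e by (auto simp: insert_commute)
    show ?thesis using meets[OF w(1)] w by auto
  qed
  have "connected_graph (\<Union>E, E)"
    unfolding connected_graph_def fst_conv snd_conv
  proof (intro ballI)
    fix u v assume "u \<in> \<Union>E" "v \<in> \<Union>E"
    then obtain c d where cd: "c \<in> C" "d \<in> C" "(u, c) \<in> ?R\<^sup>*" "(d, v) \<in> ?R\<^sup>*" using to_C by metis
    have "(c, d) \<in> ?R\<^sup>*" using clique[of c d] cd by (cases "c = d") auto
    thus "(u, v) \<in> ?R\<^sup>*" using cd by (meson rtrancl_trans)
  qed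
  moreover have "edge_distance_condition (\<Union>E, E)"
    unfolding edge_distance_condition_def snd_conv
  proof (intro allI impI)
    fix i j k l assume a: "{i, j} \<in> E \<and> {k, l} \<in> E \<and> {i, j} \<inter> {k, l} = {}"
    thus "{i, k} \<in> E \<or> {i, l} \<in> E \<or> {j, k} \<in> E \<or> {j, l} \<in> E"
      using meets[of i j] meets[of k l] clique by blast
  qed
  moreover have "chordal (\<Union>E, E)"
    unfolding chordal_def
  proof (intro allI impI)
    fix c assume a: "is_cycle (\<Union>E, E) c \<and> length c > 3"
    define m where "m = length c"
    have m: "m > 3" and dist: "distinct c" and ce: "cycle_edges c \<subseteq> E"
      using a unfolding is_cycle_def m_def by auto
    have inj: "c ! i = c ! j \<longleftrightarrow> i = j" if "i < m" "j < m" for i j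
      using dist that nth_eq_iff_index_eq unfolding m_def by blast
    have step: "{c ! i, c ! (Suc i mod m)} \<in> E" if "i < m" for i
      using ce that unfolding cycle_edges_def m_def by blast
    have chord: "has_chord (\<Union>E, E) c"
      if ij: "i < m" "j < m" "c ! i \<in> C" "c ! j \<in> C" "i \<noteq> j" "j \<noteq> Suc i mod m" "i \<noteq> Suc j mod m" for i j
    proof -
      have "{c ! i, c ! j} \<notin> cycle_edges c"
      proof
        assume "{c ! i, c ! j} \<in> cycle_edges c"
        then obtain k where k: "k < m" "{c ! i, c ! j} = {c ! k, c ! (Suc k mod m)}"
          unfolding cycle_edges_def m_def by blast
        have "Suc k mod m < m" using m by simp
        thus False using k ij inj by (auto simp: doubleton_eq_iff)
      qed
      moreover have "{c ! i, c ! j} \<in> E" using clique ij inj by blast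
      moreover have "{c ! i, c ! j} \<subseteq> set c" using ij unfolding m_def by simp
      ultimately show ?thesis unfolding has_chord_def snd_conv by blast
    qed
    have e0: "c ! 0 \<in> C \<or> c ! 1 \<in> C" using meets[OF step[of 0]] m by simp
    have e1: "c ! 1 \<in> C \<or> c ! 2 \<in> C" using meets[OF step[of 1]] m by (simp add: numeral_eq_Suc)
    have e2: "c ! 2 \<in> C \<or> c ! 3 \<in> C" using meets[OF step[of 2]] m by (simp add: numeral_eq_Suc)
    have e3: "c ! (m - 1) \<in> C \<or> c ! 0 \<in> C" using meets[OF step[of "m - 1"]] m by simp
    consider "c ! 1 \<in> C" "c ! (m - 1) \<in> C" | "c ! 0 \<in> C" "c ! 2 \<in> C" | "c ! 1 \<in> C" "c ! 3 \<in> C"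
      using e0 e1 e2 e3 by blast
    thus "has_chord (\<Union>E, E) c"
    proof cases
      case 1 thus ?thesis using chord[of 1 "m - 1"] m by auto
    next
      case 2 thus ?thesis using chord[of 0 2] m by (cases "m = 3") (auto simp: mod_less)
    next
      case 3
      have "Suc 3 mod m \<noteq> 1" using m by (cases "m = 4") auto
      thus ?thesis using chord[of 1 3] 3 m by auto
    qed
  qed
  ultimately show ?thesis using sub unfolding graph_family_def by blast
qed

lemma split_by_delete_edge:
  assumes sp: "split_by C E" and b: "b \<notin> C"
  shows "split_by C (E - {{a, b}})"
  unfolding split_by_def
proof (intro conjI ballI impI)
  fix u v assume uv: "u \<in> C" "v \<in> C" "u \<noteq> v"
  hence "{u, v} \<noteq> {a, b}" using b by (auto simp: doubleton_eq_iff)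
  thus "{u, v} \<in> E - {{a, b}}" using uv sp unfolding split_by_def by blast
next
  fix f assume "f \<in> E - {{a, b}}"
  thus "f \<inter> C \<noteq> {}" using sp unfolding split_by_def by blast
qed

lemma split_by_complete_graph: "split_by {1..n} (snd (complete_graph n))"
  unfolding split_by_def
proof (intro conjI ballI impI)
  fix e assume "e \<in> snd (complete_graph n)"
  thus "e \<inter> {1..n} \<noteq> {}" unfolding complete_graph_edges by blast
qed (simp add: complete_graph_edge_iff)

section \<open>Cyclic quotients of ideals\<close>

lemma (in cring) quotient_module_smult:
  assumes J: "ideal J R" and r: "r \<in> carrier R" and x: "x \<in> carrier R"
  shows "r \<odot>\<^bsub>quotient_module R I J\<^esub> (J +> x) = J +> (r \<otimes> x)"
proof -
  interpret J: ideal J R by (fact J)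
  have same: "J +> (r \<otimes> y) = J +> (r \<otimes> x)" if y: "y \<in> J +> x" for y
  proof -
    obtain j where j: "j \<in> J" "y = j \<oplus> x" using y unfolding a_r_coset_def' by blast
    have jc: "j \<in> carrier R" using j J.a_subset by blast
    have yc: "y \<in> carrier R" using j jc x by simp
    have "y \<ominus> x = j" unfolding j(2) using jc x by algebra
    hence "y \<ominus> x \<in> J" using j by simp
    hence "r \<otimes> (y \<ominus> x) \<in> J" using r J.I_l_closed by blast
    moreover have "r \<otimes> (y \<ominus> x) = r \<otimes> y \<ominus> r \<otimes> x" using r yc x by algebra
    ultimately show ?thesis using quotient_eq_iff_same_a_r_cos[OF J, of "r \<otimes> y" "r \<otimes> x"] r yc x by simp
  qed
  have "x \<in> J +> x" using x J.a_rcos_self by blast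
  hence "(\<Union>y\<in>J +> x. J +> (r \<otimes> y)) = J +> (r \<otimes> x)" using same by blast
  thus ?thesis unfolding quotient_module_def by simp
qed

text \<open>
If \<open>I = J + Rg\<close>, the coset of \<open>g\<close> generates \<open>I / J\<close>, and \<open>r\<close> annihilates \<open>I / J\<close> as soon as it
annihilates this coset. So the annihilator is the colon ideal \<open>J : g\<close>.
\<close>

lemma (in cring) quotient_module_principal:
  assumes J: "ideal J R" and g: "g \<in> carrier R"
    and I: "I = {j \<oplus> r \<otimes> g | j r. j \<in> J \<and> r \<in> carrier R}"
  shows "cyclic_module R (quotient_module R I J)"
    and "module_annihilator R (quotient_module R I J) = {r \<in> carrier R. r \<otimes> g \<in> J}"
proof -
  interpret J: ideal J R by (fact J)
  let ?M = "quotient_module R I J"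
  have carrier: "carrier ?M = {J +> (r \<otimes> g) | r. r \<in> carrier R}"
  proof -
    have coset: "J +> (j \<oplus> r \<otimes> g) = J +> (r \<otimes> g)" if "j \<in> J" "r \<in> carrier R" for j r
    proof -
      have jc: "j \<in> carrier R" using that J.a_subset by blast
      have "(j \<oplus> r \<otimes> g) \<ominus> r \<otimes> g = j" using jc g that by algebra
      thus ?thesis using quotient_eq_iff_same_a_r_cos[OF J, of "j \<oplus> r \<otimes> g" "r \<otimes> g"] that jc g by simp
    qed
    have "carrier ?M = {J +> x | x. x \<in> I}" unfolding quotient_module_def by simp
    also have "\<dots> = {J +> (j \<oplus> r \<otimes> g) | j r. j \<in> J \<and> r \<in> carrier R}" unfolding I by blast
    also have "\<dots> = {J +> (r \<otimes> g) | j r. j \<in> J \<and> r \<in> carrier R}" using coset by metis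
    also have "\<dots> = {J +> (r \<otimes> g) | r. r \<in> carrier R}" using J.zero_closed by blast
    finally show ?thesis .
  qed
  have gM: "J +> g \<in> carrier ?M" unfolding carrier using g l_one one_closed by (metis (mono_tags, lifting) mem_Collect_eq)
  have smult: "r \<odot>\<^bsub>?M\<^esub> (J +> x) = J +> (r \<otimes> x)" if "r \<in> carrier R" "x \<in> carrier R" for r x
    using quotient_module_smult[OF J that] .
  show "cyclic_module R ?M"
    unfolding cyclic_module_def
  proof (rule bexI[OF _ gM])
    show "carrier ?M = {r \<odot>\<^bsub>?M\<^esub> (J +> g) | r. r \<in> carrier R}"
      unfolding carrier using smult g by (metis (no_types, lifting))
  qed
  have zero: "\<zero>\<^bsub>?M\<^esub> = J" unfolding quotient_module_def by simp
  have coset_zero: "J +> x = J \<longleftrightarrow> x \<in> J" if "x \<in> carrier R" for x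
    using that J.a_rcos_const J.a_rcos_self by blast
  have ann: "(\<forall>m\<in>carrier ?M. r \<odot>\<^bsub>?M\<^esub> m = J) \<longleftrightarrow> r \<otimes> g \<in> J" if r: "r \<in> carrier R" for r
  proof
    assume "\<forall>m\<in>carrier ?M. r \<odot>\<^bsub>?M\<^esub> m = J"
    hence "J +> (r \<otimes> g) = J" using gM smult[OF r g] by simp
    thus "r \<otimes> g \<in> J" using coset_zero r g by simp
  next
    assume rg: "r \<otimes> g \<in> J"
    have "J +> (r \<otimes> (s \<otimes> g)) = J" if s: "s \<in> carrier R" for s
    proof -
      have "s \<otimes> (r \<otimes> g) \<in> J" using rg s J.I_l_closed by blast
      moreover have "s \<otimes> (r \<otimes> g) = r \<otimes> (s \<otimes> g)" using r s g by (simp add: m_lcomm)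
      ultimately show ?thesis using coset_zero r s g by simp
    qed
    thus "\<forall>m\<in>carrier ?M. r \<odot>\<^bsub>?M\<^esub> m = J" unfolding carrier using smult r g by auto
  qed
  show "module_annihilator R ?M = {r \<in> carrier R. r \<otimes> g \<in> J}"
    unfolding module_annihilator_def zero using ann by blast
qed

section \<open>Monoid rings and their monomial ideals\<close>

text \<open>
All ideals and graded pieces below are spanned by monomials over the field, so they are described by
their sets of exponents.
\<close>

definition supported :: "'a set \<Rightarrow> ('a \<Rightarrow>\<^sub>0 'k::zero) set" where
  "supported A = {p. Poly_Mapping.keys p \<subseteq> A}"

lemma supported_iff: "p \<in> supported A \<longleftrightarrow> (\<forall>m. m \<notin> A \<longrightarrow> Poly_Mapping.lookup p m = 0)"
  unfolding supported_def by (auto simp: in_keys_iff)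

lemma supported_zero: "0 \<in> supported A"
  unfolding supported_iff by simp

lemma supported_add: "p \<in> supported A \<Longrightarrow> q \<in> supported A \<Longrightarrow> p + q \<in> supported A"
  for p :: "'a \<Rightarrow>\<^sub>0 'k::monoid_add"
  unfolding supported_iff by (simp add: lookup_add)

lemma supported_uminus: "p \<in> supported A \<Longrightarrow> - p \<in> supported A"
  for p :: "'a \<Rightarrow>\<^sub>0 'k::ab_group_add"
  unfolding supported_iff by simp

lemma supported_single: "m \<in> A \<Longrightarrow> Poly_Mapping.single m c \<in> supported A"
  unfolding supported_iff by (auto simp: lookup_single when_def)

lemma supported_mono: "A \<subseteq> B \<Longrightarrow> supported A \<subseteq> supported B"
  unfolding supported_def by auto

lemma sum_of_monomials: "p = (\<Sum>m\<in>Poly_Mapping.keys p. Poly_Mapping.single m (Poly_Mapping.lookup p m))"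
  for p :: "'a \<Rightarrow>\<^sub>0 'k::comm_monoid_add"
proof (rule poly_mapping_eqI)
  fix k
  have "Poly_Mapping.lookup (\<Sum>m\<in>Poly_Mapping.keys p. Poly_Mapping.single m (Poly_Mapping.lookup p m)) k
      = (\<Sum>m\<in>Poly_Mapping.keys p. if m = k then Poly_Mapping.lookup p m else 0)"
    by (simp add: lookup_sum lookup_single when_def)
  also have "\<dots> = Poly_Mapping.lookup p k" by (auto simp: in_keys_iff)
  finally show "Poly_Mapping.lookup p k
      = Poly_Mapping.lookup (\<Sum>m\<in>Poly_Mapping.keys p. Poly_Mapping.single m (Poly_Mapping.lookup p m)) k" by simp
qed

lemma supported_induct [consumes 1, case_names zero add monomial]:
  fixes p :: "'a \<Rightarrow>\<^sub>0 'k::comm_monoid_add"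
  assumes p: "p \<in> supported A"
    and zero: "P 0" and add: "\<And>p q. P p \<Longrightarrow> P q \<Longrightarrow> P (p + q)"
    and mono: "\<And>m c. m \<in> A \<Longrightarrow> P (Poly_Mapping.single m c)"
  shows "P p"
proof -
  have "P (\<Sum>m\<in>B. Poly_Mapping.single m (Poly_Mapping.lookup p m))"
    if "finite B" "B \<subseteq> A" for B
    using that by (induction B rule: finite_induct) (auto intro: zero add mono)
  from this[of "Poly_Mapping.keys p"] p show ?thesis
    unfolding supported_def sum_of_monomials[of p, symmetric] by simp
qed

lemma supported_mult:
  fixes p q :: "'a::monoid_add \<Rightarrow>\<^sub>0 'k::semiring_0"
  assumes p: "p \<in> supported A" and q: "q \<in> supported B"
    and AB: "\<And>a b. a \<in> A \<Longrightarrow> b \<in> B \<Longrightarrow> a + b \<in> D"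
  shows "p * q \<in> supported D"
  using keys_mult[of p q] assms unfolding supported_def by blast

text \<open>
Multiplication by a monomial shifts the exponents injectively, so no cancellation can occur; hence
colon ideals of monomial ideals by monomials can be computed on exponents.
\<close>

lemma monomial_mult_supported_iff:
  fixes p :: "'a::cancel_comm_monoid_add \<Rightarrow>\<^sub>0 'k::comm_ring_1"
  shows "p * Poly_Mapping.single e 1 \<in> supported A \<longleftrightarrow> p \<in> supported {m. e + m \<in> A}"
proof -
  have lookup: "Poly_Mapping.lookup (p * Poly_Mapping.single e 1) (e + m) = Poly_Mapping.lookup p m" for m
  proof -
    have "p * Poly_Mapping.single e 1
      = (\<Sum>k\<in>Poly_Mapping.keys p. Poly_Mapping.single (e + k) (Poly_Mapping.lookup p k))"
      by (subst sum_of_monomials[of p]) (simp add: sum_distrib_right mult_single add.commute)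
    also have "Poly_Mapping.lookup \<dots> (e + m)
      = (\<Sum>k\<in>Poly_Mapping.keys p. if k = m then Poly_Mapping.lookup p k else 0)"
      by (simp add: lookup_sum lookup_single when_def)
    also have "\<dots> = Poly_Mapping.lookup p m" by (auto simp: in_keys_iff)
    finally show ?thesis .
  qed
  show ?thesis
  proof
    assume "p * Poly_Mapping.single e 1 \<in> supported A"
    thus "p \<in> supported {m. e + m \<in> A}" using lookup unfolding supported_iff by (metis mem_Collect_eq)
  next
    assume "p \<in> supported {m. e + m \<in> A}"
    thus "p * Poly_Mapping.single e 1 \<in> supported A"
      by (rule supported_mult[where B = "{e}"]) (auto intro: supported_single simp: add.commute)
  qed
qed

definition monoid_ring :: "'a::comm_monoid_add set \<Rightarrow> ('a \<Rightarrow>\<^sub>0 'k::comm_ring_1) ring" where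
  "monoid_ring M = ring_of_type_algebra \<lparr>carrier := supported M\<rparr>"

lemma monoid_ring_simps [simp]:
  "carrier (monoid_ring M) = supported M"
  "x \<oplus>\<^bsub>monoid_ring M\<^esub> y = x + y"
  "x \<otimes>\<^bsub>monoid_ring M\<^esub> y = x * y"
  "\<zero>\<^bsub>monoid_ring M\<^esub> = 0"
  "\<one>\<^bsub>monoid_ring M\<^esub> = 1"
  unfolding monoid_ring_def ring_of_type_algebra_def by simp_all

lemma type_algebra_uminus: "\<ominus>\<^bsub>ring_of_type_algebra\<^esub> x = - x"
  for x :: "'r::comm_ring_1"
proof -
  interpret cring "ring_of_type_algebra :: 'r ring" ..
  show ?thesis
    by (rule minus_equality) (simp_all add: ring_of_type_algebra_def)
qed

text \<open>
Building the ring as a subring of the full type algebra yields all ring axioms from those of the type.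
\<close>

lemma type_algebra_subring:
  fixes A :: "'r::comm_ring_1 set"
  assumes "1 \<in> A" "\<And>x. x \<in> A \<Longrightarrow> - x \<in> A"
    "\<And>x y. x \<in> A \<Longrightarrow> y \<in> A \<Longrightarrow> x + y \<in> A" "\<And>x y. x \<in> A \<Longrightarrow> y \<in> A \<Longrightarrow> x * y \<in> A"
  shows "cring (ring_of_type_algebra \<lparr>carrier := A\<rparr>)"
proof -
  interpret cring "ring_of_type_algebra :: 'r ring" ..
  have "subring A ring_of_type_algebra"
    by (rule subringI) (use assms in \<open>simp_all add: type_algebra_uminus, simp_all add: ring_of_type_algebra_def\<close>)
  thus ?thesis using subcringI' subcring_iff subringE(1) by blast
qed

lemma supported_one: "0 \<in> M \<Longrightarrow> (1 :: 'a::zero \<Rightarrow>\<^sub>0 'k::zero_neq_one) \<in> supported M"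
  using supported_single[of 0 M "1 :: 'k"] by simp

locale exponent_monoid =
  fixes M :: "'a::cancel_comm_monoid_add set"
  assumes zero_exponent: "0 \<in> M"
    and add_exponent: "a \<in> M \<Longrightarrow> b \<in> M \<Longrightarrow> a + b \<in> M"
begin

lemma cring_monoid_ring: "cring (monoid_ring M :: ('a \<Rightarrow>\<^sub>0 'k::comm_ring_1) ring)"
  unfolding monoid_ring_def
  by (rule type_algebra_subring)
    (use zero_exponent add_exponent in \<open>auto intro: supported_one supported_add supported_uminus supported_mult\<close>)

lemma monoid_ring_uminus: "x \<in> supported M \<Longrightarrow> \<ominus>\<^bsub>monoid_ring M\<^esub> x = - x"
  for x :: "'a \<Rightarrow>\<^sub>0 'k::comm_ring_1"
proof -
  interpret cring "monoid_ring M :: ('a \<Rightarrow>\<^sub>0 'k) ring" by (rule cring_monoid_ring)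
  assume "x \<in> supported M"
  thus ?thesis by (intro minus_equality) (simp_all add: supported_uminus)
qed

lemma monoid_ring_finsum:
  fixes f :: "'b \<Rightarrow> 'a \<Rightarrow>\<^sub>0 'k::comm_ring_1"
  assumes "finite B" "\<And>b. b \<in> B \<Longrightarrow> f b \<in> supported M"
  shows "finsum (monoid_ring M) f B = sum f B"
proof -
  interpret cring "monoid_ring M :: ('a \<Rightarrow>\<^sub>0 'k) ring" by (rule cring_monoid_ring)
  show ?thesis using assms
    by (induction B rule: finite_induct) (simp_all add: finsum_insert Pi_def)
qed

lemma supported_subgroup:
  assumes "A \<subseteq> M"
  shows "subgroup (supported A) (add_monoid (monoid_ring M :: ('a \<Rightarrow>\<^sub>0 'k::comm_ring_1) ring))"
proof -
  interpret cring "monoid_ring M :: ('a \<Rightarrow>\<^sub>0 'k) ring" by (rule cring_monoid_ring)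
  have sub: "supported A \<subseteq> (supported M :: ('a \<Rightarrow>\<^sub>0 'k) set)" using assms by (rule supported_mono)
  show ?thesis
  proof (rule add.subgroupI)
    fix x :: "'a \<Rightarrow>\<^sub>0 'k" assume x: "x \<in> supported A"
    thus "\<ominus>\<^bsub>monoid_ring M\<^esub> x \<in> supported A"
      using monoid_ring_uminus[of x] sub by (auto simp: supported_uminus)
  qed (use sub in \<open>auto intro: supported_add supported_zero\<close>)
qed

lemma supported_ideal:
  assumes "A \<subseteq> M" and "\<And>a m. a \<in> A \<Longrightarrow> m \<in> M \<Longrightarrow> a + m \<in> A"
  shows "ideal (supported A) (monoid_ring M :: ('a \<Rightarrow>\<^sub>0 'k::comm_ring_1) ring)"
proof -
  interpret cring "monoid_ring M :: ('a \<Rightarrow>\<^sub>0 'k) ring" by (rule cring_monoid_ring)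
  have mult: "a * x \<in> supported A" if "a \<in> supported A" "x \<in> supported M" for a x :: "'a \<Rightarrow>\<^sub>0 'k"
    using that assms(2) by (rule supported_mult)
  show ?thesis
    by (rule idealI[OF ring_axioms supported_subgroup[OF assms(1)]])
      (use mult in \<open>auto simp: mult.commute\<close>)
qed

definition multiples :: "'a set \<Rightarrow> 'a set" where
  "multiples S = {s + m | s m. s \<in> S \<and> m \<in> M}"

lemma multiples_subset: "S \<subseteq> M \<Longrightarrow> multiples S \<subseteq> M"
  unfolding multiples_def using add_exponent by auto

lemma multiples_absorb: "a \<in> multiples S \<Longrightarrow> m \<in> M \<Longrightarrow> a + m \<in> multiples S"
  unfolding multiples_def by (auto simp: add.assoc) (metis add_exponent)

lemma multiples_self: "s \<in> S \<Longrightarrow> s \<in> multiples S"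
  unfolding multiples_def using zero_exponent add_0_right[of s] by (metis (mono_tags, lifting) mem_Collect_eq)

lemma monomial_ideal:
  assumes S: "S \<subseteq> M"
  shows "Idl\<^bsub>monoid_ring M\<^esub> ((\<lambda>s. Poly_Mapping.single s 1) ` S)
    = (supported (multiples S) :: ('a \<Rightarrow>\<^sub>0 'k::comm_ring_1) set)"
proof
  interpret cring "monoid_ring M :: ('a \<Rightarrow>\<^sub>0 'k) ring" by (rule cring_monoid_ring)
  let ?X = "(\<lambda>s. Poly_Mapping.single s 1) ` S :: ('a \<Rightarrow>\<^sub>0 'k) set"
  have X: "?X \<subseteq> carrier (monoid_ring M)" using S by (auto intro: supported_single)
  have "ideal (supported (multiples S)) (monoid_ring M :: ('a \<Rightarrow>\<^sub>0 'k) ring)"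
    by (rule supported_ideal[OF multiples_subset[OF S] multiples_absorb])
  moreover have "?X \<subseteq> supported (multiples S)"
    using multiples_self by (auto intro: supported_single)
  ultimately show "Idl\<^bsub>monoid_ring M\<^esub> ?X \<subseteq> supported (multiples S)"
    by (rule genideal_minimal)
  interpret I: ideal "Idl\<^bsub>monoid_ring M\<^esub> ?X" "monoid_ring M :: ('a \<Rightarrow>\<^sub>0 'k) ring"
    by (rule genideal_ideal[OF X])
  show "supported (multiples S) \<subseteq> Idl\<^bsub>monoid_ring M\<^esub> ?X"
  proof
    fix p :: "'a \<Rightarrow>\<^sub>0 'k" assume "p \<in> supported (multiples S)"
    thus "p \<in> Idl\<^bsub>monoid_ring M\<^esub> ?X"
    proof (induction rule: supported_induct)
      case zero show ?case using I.zero_closed by simp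
    next
      case (add p q) thus ?case using I.a_closed[of p q] by simp
    next
      case (monomial m c)
      then obtain s k where sk: "m = s + k" "s \<in> S" "k \<in> M" unfolding multiples_def by blast
      have "Poly_Mapping.single s 1 \<in> Idl\<^bsub>monoid_ring M\<^esub> ?X" using genideal_self[OF X] sk by blast
      hence "Poly_Mapping.single s 1 * Poly_Mapping.single k c \<in> Idl\<^bsub>monoid_ring M\<^esub> ?X"
        using I.I_r_closed[of "Poly_Mapping.single s 1" "Poly_Mapping.single k c"] sk
        by (simp add: supported_single)
      thus ?case using sk by (simp add: mult_single)
    qed
  qed
qed

lemma monomial_ideal_insert:
  assumes S: "S \<subseteq> M" and e: "e \<in> M"
  shows "(supported (multiples (insert e S)) :: ('a \<Rightarrow>\<^sub>0 'k::comm_ring_1) set)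
    = {j + r * Poly_Mapping.single e 1 | j r. j \<in> supported (multiples S) \<and> r \<in> supported M}"
    (is "?I = ?R")
proof
  show "?I \<subseteq> ?R"
  proof
    fix p :: "'a \<Rightarrow>\<^sub>0 'k" assume "p \<in> ?I"
    thus "p \<in> ?R"
    proof (induction rule: supported_induct)
      case zero
      show ?case by (intro CollectI exI[of _ 0]) (simp add: supported_zero)
    next
      case (add p q)
      then obtain j r j' r' where *: "p = j + r * Poly_Mapping.single e 1" "q = j' + r' * Poly_Mapping.single e 1"
        "j \<in> supported (multiples S)" "j' \<in> supported (multiples S)" "r \<in> supported M" "r' \<in> supported M"
        by blast
      have "p + q = (j + j') + (r + r') * Poly_Mapping.single e 1"
        unfolding *(1,2) by (simp add: algebra_simps)
      thus ?case
        by (intro CollectI exI[of _ "j + j'"] exI[of _ "r + r'"]) (simp add: supported_add *(3-))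
    next
      case (monomial m c)
      then obtain s k where sk: "m = s + k" "s \<in> insert e S" "k \<in> M" unfolding multiples_def by blast
      show ?case
      proof (cases "s = e")
        case True
        hence "Poly_Mapping.single m c = 0 + Poly_Mapping.single k c * Poly_Mapping.single e 1"
          using sk by (simp add: mult_single add.commute)
        thus ?thesis
          by (intro CollectI exI[of _ 0] exI[of _ "Poly_Mapping.single k c"])
            (simp add: supported_zero supported_single[OF sk(3)])
      next
        case False
        hence "m \<in> multiples S" using sk unfolding multiples_def by blast
        hence "Poly_Mapping.single m c \<in> supported (multiples S)" by (rule supported_single)
        thus ?thesis
          by (intro CollectI exI[of _ "Poly_Mapping.single m c"] exI[of _ 0]) (simp add: supported_zero)
      qed
    qed
  qed
  show "?R \<subseteq> ?I"
  proof
    fix p assume "p \<in> ?R"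
    then obtain j r where p: "p = j + r * Poly_Mapping.single e 1"
      and j: "j \<in> supported (multiples S)" and r: "r \<in> supported M" by blast
    have "j \<in> ?I" using j supported_mono[of "multiples S" "multiples (insert e S)"]
      unfolding multiples_def by blast
    moreover have "r * Poly_Mapping.single e 1 \<in> ?I"
    proof (rule supported_mult[OF r])
      show "Poly_Mapping.single e 1 \<in> supported {e}" by (simp add: supported_single)
      show "a + b \<in> multiples (insert e S)" if "a \<in> M" "b \<in> {e}" for a b
        using that unfolding multiples_def by (auto simp: add.commute[of a])
    qed
    ultimately show "p \<in> ?I" unfolding p by (rule supported_add)
  qed
qed

text \<open>
Passing from the monomial ideal of \<open>S\<close> to that of \<open>insert e S\<close> adds a single generator, which turns the
cyclic step of a Koszul filtration into a question about exponents.
\<close>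

lemma monomial_ideal_step:
  assumes S: "S \<subseteq> M" and e: "e \<in> M"
  defines "I \<equiv> supported (multiples (insert e S)) :: ('a \<Rightarrow>\<^sub>0 'k::comm_ring_1) set"
    and "J \<equiv> supported (multiples S) :: ('a \<Rightarrow>\<^sub>0 'k) set"
  shows "cyclic_module (monoid_ring M) (quotient_module (monoid_ring M) I J)"
    and "module_annihilator (monoid_ring M) (quotient_module (monoid_ring M) I J)
      = supported {m \<in> M. e + m \<in> multiples S}"
proof -
  interpret cring "monoid_ring M :: ('a \<Rightarrow>\<^sub>0 'k) ring" by (rule cring_monoid_ring)
  have J: "ideal J (monoid_ring M)"
    unfolding J_def by (rule supported_ideal[OF multiples_subset[OF S] multiples_absorb])
  have g: "Poly_Mapping.single e 1 \<in> carrier (monoid_ring M :: ('a \<Rightarrow>\<^sub>0 'k) ring)"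
    using e by (simp add: supported_single)
  have I: "I = {j \<oplus>\<^bsub>monoid_ring M\<^esub> r \<otimes>\<^bsub>monoid_ring M\<^esub> Poly_Mapping.single e 1 | j r.
      j \<in> J \<and> r \<in> carrier (monoid_ring M)}"
    unfolding I_def J_def using monomial_ideal_insert[OF S e] by simp
  show "cyclic_module (monoid_ring M) (quotient_module (monoid_ring M) I J)"
    by (rule quotient_module_principal(1)[OF J g I])
  have "{r \<in> carrier (monoid_ring M). r \<otimes>\<^bsub>monoid_ring M\<^esub> Poly_Mapping.single e 1 \<in> J}
      = {r \<in> supported M. r \<in> supported {m. e + m \<in> multiples S}}"
    unfolding J_def by (simp add: monomial_mult_supported_iff)
  also have "\<dots> = supported {m \<in> M. e + m \<in> multiples S}" unfolding supported_def by auto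
  finally show "module_annihilator (monoid_ring M) (quotient_module (monoid_ring M) I J)
      = supported {m \<in> M. e + m \<in> multiples S}"
    using quotient_module_principal(2)[OF J g I] by simp
qed

lemma constants_subfield:
  "subfield (range (Poly_Mapping.single 0)) (monoid_ring M :: ('a \<Rightarrow>\<^sub>0 'k::field) ring)"
proof -
  interpret cring "monoid_ring M :: ('a \<Rightarrow>\<^sub>0 'k) ring" by (rule cring_monoid_ring)
  let ?K = "range (Poly_Mapping.single 0) :: ('a \<Rightarrow>\<^sub>0 'k) set"
  have K: "?K \<subseteq> supported M" using zero_exponent by (auto intro: supported_single)
  have "subring ?K (monoid_ring M)"
  proof (rule subringI)
    fix x assume x: "x \<in> ?K"
    then obtain c where "x = Poly_Mapping.single 0 c" by blast
    thus "\<ominus>\<^bsub>monoid_ring M\<^esub> x \<in> ?K" using monoid_ring_uminus[of x] K x by (auto simp flip: single_uminus)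
  next
    show "\<one>\<^bsub>monoid_ring M\<^esub> \<in> ?K" by (metis monoid_ring_simps(5) rangeI single_one)
  qed (use K in \<open>auto simp: mult_single simp flip: single_add\<close>)
  hence sub: "subcring ?K (monoid_ring M)" by (rule subcringI')
  show ?thesis
  proof (rule subfieldI[OF sub])
    show "Units (monoid_ring M \<lparr>carrier := ?K\<rparr>) = ?K - {\<zero>\<^bsub>monoid_ring M\<^esub>}"
    proof
      show "Units (monoid_ring M \<lparr>carrier := ?K\<rparr>) \<subseteq> ?K - {\<zero>\<^bsub>monoid_ring M\<^esub>}"
        unfolding Units_def by auto
      show "?K - {\<zero>\<^bsub>monoid_ring M\<^esub>} \<subseteq> Units (monoid_ring M \<lparr>carrier := ?K\<rparr>)"
      proof
        fix x assume "x \<in> ?K - {\<zero>\<^bsub>monoid_ring M\<^esub>}"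
        then obtain c where c: "x = Poly_Mapping.single 0 c" "x \<noteq> 0" by auto
        hence "c \<noteq> 0" by (metis single_zero)
        note c = c(1) this
        have "Poly_Mapping.single 0 (inverse c) * x = 1" "x * Poly_Mapping.single 0 (inverse c) = 1"
          using c by (simp_all add: mult_single)
        thus "x \<in> Units (monoid_ring M \<lparr>carrier := ?K\<rparr>)"
          unfolding Units_def using c by auto
      qed
    qed
  qed
qed

end

section \<open>Exponent vectors of products of edges\<close>

definition edge_exponent :: "nat \<Rightarrow> nat \<Rightarrow> nat \<Rightarrow>\<^sub>0 nat" where
  "edge_exponent i j = Poly_Mapping.single i 1 + Poly_Mapping.single j 1"

lemma edge_exponent_commute: "edge_exponent i j = edge_exponent j i"
  unfolding edge_exponent_def by (simp add: add.commute)

lemma lookup_edge_exponent: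
  "Poly_Mapping.lookup (edge_exponent i j) k = (if k = i then 1 else 0) + (if k = j then 1 else 0)"
  unfolding edge_exponent_def by (auto simp: lookup_add lookup_single when_def)

lemma keys_edge_exponent: "Poly_Mapping.keys (edge_exponent i j) = {i, j}"
proof -
  have "k \<in> Poly_Mapping.keys (edge_exponent i j) \<longleftrightarrow> k = i \<or> k = j" for k
    unfolding in_keys_iff lookup_edge_exponent by simp
  thus ?thesis by blast
qed

lemma edge_exponent_eq_iff: "edge_exponent i j = edge_exponent k l \<longleftrightarrow> {i, j} = {k, l}"
proof
  assume "edge_exponent i j = edge_exponent k l"
  thus "{i, j} = {k, l}" using keys_edge_exponent by metis
next
  assume "{i, j} = {k, l}"
  hence "i = k \<and> j = l \<or> i = l \<and> j = k" by (simp add: doubleton_eq_iff)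
  thus "edge_exponent i j = edge_exponent k l" using edge_exponent_commute by blast
qed

definition exponent_sum :: "nat \<Rightarrow> (nat \<Rightarrow>\<^sub>0 nat) \<Rightarrow> nat" where
  "exponent_sum n m = (\<Sum>i\<in>{1..n}. Poly_Mapping.lookup m i)"

lemma exponent_sum_add: "exponent_sum n (a + b) = exponent_sum n a + exponent_sum n b"
  unfolding exponent_sum_def by (simp add: lookup_add sum.distrib)

lemma exponent_sum_edge_exponent:
  assumes "i \<in> {1..n}" "j \<in> {1..n}"
  shows "exponent_sum n (edge_exponent i j) = 2"
  using assms unfolding exponent_sum_def by (simp add: lookup_edge_exponent sum.distrib)

lemma sum_lookup_le_exponent_sum:
  assumes "Poly_Mapping.keys m \<subseteq> {1..n}" "finite A"
  shows "(\<Sum>i\<in>A. Poly_Mapping.lookup m i) \<le> exponent_sum n m"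
proof -
  have "(\<Sum>i\<in>A. Poly_Mapping.lookup m i) = (\<Sum>i\<in>A \<inter> {1..n}. Poly_Mapping.lookup m i)"
    using assms by (intro sum.mono_neutral_right) (auto simp: in_keys_iff subset_iff)
  also have "\<dots> \<le> exponent_sum n m" unfolding exponent_sum_def by (rule sum_mono2) auto
  finally show ?thesis .
qed

text \<open>
These are the exponent vectors of products of \<open>d\<close> edges of the complete graph, that is, the degree
sequences of loopless multigraphs with \<open>d\<close> edges: the bound \<open>d\<close> on each entry expresses that there
are no loops. The description by inequalities makes membership easy to decide.
\<close>

definition exponents :: "nat \<Rightarrow> nat \<Rightarrow> (nat \<Rightarrow>\<^sub>0 nat) set" where
  "exponents n d = {m. Poly_Mapping.keys m \<subseteq> {1..n} \<and> exponent_sum n m = 2 * d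
                      \<and> (\<forall>i. Poly_Mapping.lookup m i \<le> d)}"

lemma exponents_keys: "m \<in> exponents n d \<Longrightarrow> Poly_Mapping.keys m \<subseteq> {1..n}"
  and exponents_exponent_sum: "m \<in> exponents n d \<Longrightarrow> exponent_sum n m = 2 * d"
  and exponents_le: "m \<in> exponents n d \<Longrightarrow> Poly_Mapping.lookup m i \<le> d"
  unfolding exponents_def by auto

lemma exponents_support: "m \<in> exponents n d \<Longrightarrow> Poly_Mapping.lookup m i \<ge> 1 \<Longrightarrow> i \<in> {1..n}"
  using exponents_keys[of m n d] by (auto simp: subset_iff in_keys_iff)

lemma exponents_0: "exponents n 0 = {0}"
proof -
  have "m = 0" if "m \<in> exponents n 0" for m
    by (rule poly_mapping_eqI) (use exponents_le[OF that] in simp)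
  moreover have "0 \<in> exponents n 0" unfolding exponents_def exponent_sum_def by simp
  ultimately show ?thesis by blast
qed

lemma exponents_add: "a \<in> exponents n c \<Longrightarrow> b \<in> exponents n d \<Longrightarrow> a + b \<in> exponents n (c + d)"
  using keys_add[of a b] unfolding exponents_def by (auto simp: exponent_sum_add lookup_add intro: add_mono)

lemma edge_exponent_mem: 
  assumes "i \<in> {1..n}" "j \<in> {1..n}" "i \<noteq> j"
  shows "edge_exponent i j \<in> exponents n 1"
proof -
  have "Poly_Mapping.lookup (edge_exponent i j) k \<le> 1" for k
    using assms by (simp add: lookup_edge_exponent)
  thus ?thesis using assms exponent_sum_edge_exponent[of i n j] unfolding exponents_def by (simp add: keys_edge_exponent)
qed

text \<open>
An edge can be split off whenever it meets all saturated vertices, those whose exponent is the largest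
possible one \<open>Suc d\<close>.
\<close>

lemma exponents_split_edge:
  assumes m: "m \<in> exponents n (Suc d)" and kl: "k \<noteq> l"
    and pos: "Poly_Mapping.lookup m k \<ge> 1" "Poly_Mapping.lookup m l \<ge> 1"
    and rest: "\<And>i. i \<noteq> k \<Longrightarrow> i \<noteq> l \<Longrightarrow> Poly_Mapping.lookup m i \<le> d"
  obtains m' where "m' \<in> exponents n d" "m = edge_exponent k l + m'"
proof -
  define m' where "m' = m - edge_exponent k l"
  have lookup: "Poly_Mapping.lookup m' i = Poly_Mapping.lookup m i - Poly_Mapping.lookup (edge_exponent k l) i" for i
    unfolding m'_def by (simp add: lookup_minus)
  have eq: "m = edge_exponent k l + m'"
    by (rule poly_mapping_eqI) (use kl pos in \<open>auto simp: lookup_add lookup lookup_edge_exponent\<close>)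
  have in_n: "k \<in> {1..n}" "l \<in> {1..n}" using exponents_support[OF m] pos by auto
  have "exponent_sum n m' = 2 * d"
    using exponents_exponent_sum[OF m] eq exponent_sum_add[of n "edge_exponent k l" m'] exponent_sum_edge_exponent[OF in_n] by simp
  moreover have "Poly_Mapping.keys m' \<subseteq> Poly_Mapping.keys m"
    by (auto simp: in_keys_iff lookup)
  moreover have "Poly_Mapping.lookup m' i \<le> d" for i
    using rest[of i] exponents_le[OF m, of i] kl unfolding lookup lookup_edge_exponent by auto
  ultimately have "m' \<in> exponents n d" using exponents_keys[OF m] unfolding exponents_def by auto
  thus thesis using that eq by blast
qed

text \<open>
Splitting off the edge from \<open>c\<close> to a vertex \<open>l \<noteq> b\<close> of largest exponent works: a further saturated
vertex \<open>i\<close> would give \<open>c\<close>, \<open>i\<close> and \<open>l\<close> together an exponent sum above \<open>2 * Suc d\<close>.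
Since \<open>b\<close> is not saturated, it cannot be the only other vertex that occurs in \<open>m\<close>.
\<close>

lemma exponents_split_edge_avoiding:
  assumes m: "m \<in> exponents n (Suc d)" and c: "Poly_Mapping.lookup m c \<ge> 1"
    and b: "b \<noteq> c" "Poly_Mapping.lookup m b \<le> d"
  obtains l m' where "l \<in> {1..n}" "l \<noteq> c" "l \<noteq> b" "m' \<in> exponents n d" "m = edge_exponent c l + m'"
proof -
  let ?L = "{1..n} - {c, b}"
  have cn: "c \<in> {1..n}" using exponents_support[OF m c] .
  have pos: "\<exists>i\<in>?L. Poly_Mapping.lookup m i \<ge> 1"
  proof (rule ccontr)
    assume "\<not> ?thesis"
    hence "\<forall>i\<in>{1..n} - ({c, b} \<inter> {1..n}). Poly_Mapping.lookup m i = 0" by force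
    hence "exponent_sum n m = (\<Sum>i\<in>{c, b} \<inter> {1..n}. Poly_Mapping.lookup m i)"
      unfolding exponent_sum_def by (intro sum.mono_neutral_right) simp_all
    also have "\<dots> \<le> (\<Sum>i\<in>{c, b}. Poly_Mapping.lookup m i)" by (rule sum_mono2) auto
    also have "\<dots> \<le> Suc d + d" using b exponents_le[OF m, of c] by simp
    finally show False using exponents_exponent_sum[OF m] by simp
  qed
  hence "?L \<noteq> {}" by auto
  then obtain l where l: "l \<in> ?L" and "Poly_Mapping.lookup m l = Max (Poly_Mapping.lookup m ` ?L)"
    using Max_in[of "Poly_Mapping.lookup m ` ?L"] by (metis (no_types, lifting) finite_Diff finite_atLeastAtMost finite_imageI image_iff image_is_empty)
  hence max: "Poly_Mapping.lookup m i \<le> Poly_Mapping.lookup m l" if "i \<in> ?L" for i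
    using that by simp
  have lpos: "Poly_Mapping.lookup m l \<ge> 1" using pos max by force
  have "Poly_Mapping.lookup m i \<le> d" if i: "i \<noteq> c" "i \<noteq> l" for i
  proof (cases "i = b \<or> i \<notin> {1..n}")
    case True
    thus ?thesis using b exponents_support[OF m, of i] by (cases "Poly_Mapping.lookup m i") auto
  next
    case False
    hence le: "Poly_Mapping.lookup m i \<le> Poly_Mapping.lookup m l" using max i by auto
    have "(\<Sum>j\<in>{i, c, l}. Poly_Mapping.lookup m j) \<le> 2 * Suc d"
      using sum_lookup_le_exponent_sum[OF exponents_keys[OF m], of "{i, c, l}"] exponents_exponent_sum[OF m] by simp
    hence "Poly_Mapping.lookup m i + Poly_Mapping.lookup m c + Poly_Mapping.lookup m l \<le> 2 * Suc d"
      using i l by auto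
    thus ?thesis using le c by arith
  qed
  then obtain m' where "m' \<in> exponents n d" "m = edge_exponent c l + m'"
    using exponents_split_edge[OF m _ c lpos] l by blast
  thus thesis using that l by blast
qed

lemma exponents_Suc_edge:
  assumes m: "m \<in> exponents n (Suc d)"
  obtains k l m' where "k \<in> {1..n}" "l \<in> {1..n}" "k \<noteq> l" "m' \<in> exponents n d" "m = edge_exponent k l + m'"
proof -
  obtain c where c: "Poly_Mapping.lookup m c \<ge> 1"
  proof (rule ccontr)
    assume "\<not> thesis"
    hence "Poly_Mapping.lookup m c = 0" for c using that by (metis not_less_eq_eq One_nat_def le_0_eq)
    thus False using exponents_exponent_sum[OF m] unfolding exponent_sum_def by simp
  qed
  have cn: "c \<in> {1..n}" using exponents_support[OF m c] .
  \<comment> \<open>\<open>0\<close> is not a vertex, so avoiding it is no restriction.\<close>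
  have "Poly_Mapping.lookup m 0 = 0" using exponents_support[OF m, of 0] by (cases "Poly_Mapping.lookup m 0") auto
  thus thesis using exponents_split_edge_avoiding[OF m c, of 0] cn that by (metis atLeastAtMost_iff le0 not_one_le_zero)
qed

abbreviation all_exponents :: "nat \<Rightarrow> (nat \<Rightarrow>\<^sub>0 nat) set" where
  "all_exponents n \<equiv> \<Union>d. exponents n d"

interpretation Exp: exponent_monoid "all_exponents n" for n
proof
  show "0 \<in> all_exponents n" using exponents_0 by blast
  show "a + b \<in> all_exponents n" if "a \<in> all_exponents n" "b \<in> all_exponents n" for a b
    using that exponents_add by blast
qed

definition edge_exponents :: "nat set set \<Rightarrow> (nat \<Rightarrow>\<^sub>0 nat) set" where
  "edge_exponents E = {edge_exponent i j | i j. {i, j} \<in> E}"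

lemma edge_exponents_insert:
  "edge_exponents (insert {a, b} E) = insert (edge_exponent a b) (edge_exponents E)"
proof (intro equalityI subsetI)
  fix s assume "s \<in> edge_exponents (insert {a, b} E)"
  then obtain i j where ij: "s = edge_exponent i j" "{i, j} \<in> insert {a, b} E"
    unfolding edge_exponents_def by blast
  show "s \<in> insert (edge_exponent a b) (edge_exponents E)"
  proof (cases "{i, j} = {a, b}")
    case True thus ?thesis using ij edge_exponent_eq_iff by blast
  next
    case False thus ?thesis using ij unfolding edge_exponents_def by blast
  qed
next
  fix s assume "s \<in> insert (edge_exponent a b) (edge_exponents E)"
  thus "s \<in> edge_exponents (insert {a, b} E)" unfolding edge_exponents_def by blast
qed

lemma edge_exponents_subset:
  assumes "E \<subseteq> snd (complete_graph n)"
  shows "edge_exponents E \<subseteq> exponents n 1"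
proof
  fix s assume "s \<in> edge_exponents E"
  then obtain i j where ij: "s = edge_exponent i j" "{i, j} \<in> E" unfolding edge_exponents_def by blast
  then obtain k l where "{i, j} = {k, l}" "k \<in> {1..n}" "l \<in> {1..n}" "k \<noteq> l"
    using assms unfolding complete_graph_edges by blast
  thus "s \<in> exponents n 1" using ij edge_exponent_mem[of k n l] edge_exponent_eq_iff[of k l i j] by auto
qed

lemma multiples_edge_iff:
  "m \<in> Exp.multiples n (edge_exponents E) \<longleftrightarrow> (\<exists>i j d. \<exists>m'\<in>exponents n d. {i, j} \<in> E \<and> m = edge_exponent i j + m')"
  unfolding Exp.multiples_def edge_exponents_def by blast

text \<open>
The key computation: for a split graph \<open>E\<close> and an edge \<open>ab\<close> from the clique to the independent part,
the colon ideal of \<open>E' = E - ab\<close> by \<open>t\<^sub>a t\<^sub>b\<close> is the edge ideal of a graph \<open>E''\<close>, which is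
again split. Let \<open>N\<close> be the neighbourhood of \<open>a\<close> in \<open>E'\<close>; it contains the clique except \<open>a\<close>, so every
edge of \<open>E'\<close> meets \<open>N\<close>. If \<open>k \<in> N\<close> and \<open>l \<noteq> b\<close>, then
\<open>t\<^sub>k t\<^sub>l t\<^sub>a t\<^sub>b = (t\<^sub>a t\<^sub>k) (t\<^sub>b t\<^sub>l)\<close> puts \<open>kl\<close> into the colon ideal.
Conversely, a monomial in the colon ideal contains some \<open>t\<^sub>c\<close> with \<open>c \<in> N\<close>, and an edge
\<open>cl\<close> with \<open>l \<noteq> b\<close> can be split off unless \<open>b\<close> is saturated; in that case saturation forces the
edge of \<open>E'\<close> that was used to be \<open>cb\<close> itself.
\<close>

lemma split_colon:
  assumes E: "E \<subseteq> snd (complete_graph n)" and sp: "split_by C E"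
    and ab: "{a, b} \<in> E" "a \<in> C" "b \<notin> C"
  defines "E' \<equiv> E - {{a, b}}"
  defines "N \<equiv> {k. {a, k} \<in> E'}"
  defines "E'' \<equiv> {{k, l} | k l. k \<in> N \<and> l \<in> {1..n} \<and> k \<noteq> l \<and> (l = b \<longrightarrow> {k, b} \<in> E')}"
  shows "E'' \<subseteq> snd (complete_graph n)" and "split_by N E''"
    and "{m \<in> all_exponents n. edge_exponent a b + m \<in> Exp.multiples n (edge_exponents E')}
      = Exp.multiples n (edge_exponents E'')"
proof -
  have edge: "u \<noteq> v \<and> u \<in> {1..n} \<and> v \<in> {1..n}" if "{u, v} \<in> E" for u v
    using complete_graph_edge_iff E that by blast
  have ab_in: "a \<in> {1..n}" "b \<in> {1..n}" "a \<noteq> b" using edge[OF ab(1)] by auto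
  have Nn: "k \<in> {1..n}" if "k \<in> N" for k
    using edge that unfolding N_def E'_def by blast
  have aN: "a \<notin> N" "b \<notin> N" using edge[of a a] unfolding N_def E'_def by auto
  show E''_sub: "E'' \<subseteq> snd (complete_graph n)"
    unfolding E''_def complete_graph_edges using Nn by blast
  show "split_by N E''"
    unfolding split_by_def
  proof (intro conjI ballI impI)
    fix u v assume "u \<in> N" "v \<in> N" "u \<noteq> v"
    thus "{u, v} \<in> E''" unfolding E''_def using Nn[of v] aN by blast
  next
    fix e assume "e \<in> E''" thus "e \<inter> N \<noteq> {}" unfolding E''_def by blast
  qed
  have meets: "c \<in> N \<or> d \<in> N" if cd: "{c, d} \<in> E'" for c d
  proof -
    have *: "x \<in> N \<or> y \<in> N" if xy: "{x, y} \<in> E'" "x \<in> C" for x y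
    proof (cases "x = a")
      case True thus ?thesis using xy unfolding N_def by simp
    next
      case False
      hence "{a, x} \<in> E" using sp ab(2) xy(2) unfolding split_by_def by (metis (no_types))
      moreover have "x \<noteq> b" using xy(2) ab(3) by blast
      hence "{a, x} \<noteq> {a, b}" using False by (simp add: doubleton_eq_iff)
      ultimately show ?thesis unfolding N_def E'_def by blast
    qed
    have "{c, d} \<in> E" using cd unfolding E'_def by (rule DiffD1)
    hence "{c, d} \<inter> C \<noteq> {}" using sp unfolding split_by_def by (rule bspec[OF conjunct2, rotated])
    hence "c \<in> C \<or> d \<in> C" by auto
    thus ?thesis using *[of c d] *[of d c] cd by (auto simp: insert_commute)
  qed
  show "{m \<in> all_exponents n. edge_exponent a b + m \<in> Exp.multiples n (edge_exponents E')}
      = Exp.multiples n (edge_exponents E'')"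
  proof (intro equalityI subsetI)
    fix m assume "m \<in> Exp.multiples n (edge_exponents E'')"
    then obtain i j d m' where ij: "{i, j} \<in> E''" "m = edge_exponent i j + m'" "m' \<in> exponents n d"
      unfolding multiples_edge_iff by blast
    have "edge_exponent i j \<in> exponents n 1"
      using edge_exponents_subset[OF E''_sub] ij unfolding edge_exponents_def by blast
    hence mM: "m \<in> all_exponents n" using ij exponents_add by blast
    obtain k l where kl: "{i, j} = {k, l}" "k \<in> N" "l \<in> {1..n}" "k \<noteq> l" "l = b \<longrightarrow> {k, b} \<in> E'"
      using ij(1) unfolding E''_def by blast
    have m: "m = edge_exponent k l + m'"
      using ij kl edge_exponent_eq_iff[of k l i j] by simp
    have "edge_exponent a b + m \<in> Exp.multiples n (edge_exponents E')"
    proof (cases "l = b")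
      case True
      have "edge_exponent a b + m = edge_exponent k b + (edge_exponent a b + m')"
        unfolding m True by (simp add: ac_simps)
      moreover have "edge_exponent a b + m' \<in> exponents n (1 + d)"
        using edge_exponent_mem[OF ab_in] ij(3) by (rule exponents_add)
      ultimately show ?thesis unfolding multiples_edge_iff using True kl by blast
    next
      case False
      have "edge_exponent a b + m = edge_exponent a k + (edge_exponent b l + m')"
        unfolding m edge_exponent_def by (simp add: ac_simps)
      moreover have "edge_exponent b l + m' \<in> exponents n (1 + d)"
        using edge_exponent_mem[of b n l] ab_in kl False ij(3) by (intro exponents_add) auto
      moreover have "{a, k} \<in> E'" using kl unfolding N_def by simp
      ultimately show ?thesis unfolding multiples_edge_iff by blast
    qed
    thus "m \<in> {m \<in> all_exponents n. edge_exponent a b + m \<in> Exp.multiples n (edge_exponents E')}"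
      using mM by blast
  next
    fix m assume "m \<in> {m \<in> all_exponents n. edge_exponent a b + m \<in> Exp.multiples n (edge_exponents E')}"
    then obtain d i j d' w where m: "m \<in> exponents n d" and w: "w \<in> exponents n d'" and ij: "{i, j} \<in> E'"
      and eq: "edge_exponent a b + m = edge_exponent i j + w"
      unfolding multiples_edge_iff by blast
    \<comment> \<open>Of the two ends of the edge \<open>ij\<close>, the one in \<open>N\<close> is called \<open>c\<close>.\<close>
    obtain c e where ce: "{c, e} \<in> E'" "c \<in> N" "edge_exponent a b + m = edge_exponent c e + w"
      using meets[OF ij] ij eq by (metis edge_exponent_commute insert_commute)
    have ce_in: "c \<noteq> e" "c \<in> {1..n}" "e \<in> {1..n}" using edge[of c e] ce unfolding E'_def by auto
    have cab: "c \<noteq> a" "c \<noteq> b" using ce aN by auto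
    have look: "Poly_Mapping.lookup (edge_exponent a b) x + Poly_Mapping.lookup m x
        = Poly_Mapping.lookup (edge_exponent c e) x + Poly_Mapping.lookup w x" for x
      using ce(3) by (metis lookup_add)
    have "exponent_sum n (edge_exponent a b) + exponent_sum n m = exponent_sum n (edge_exponent c e) + exponent_sum n w"
      using ce(3) by (metis exponent_sum_add)
    hence dd: "d' = d"
      using exponent_sum_edge_exponent ab_in ce_in exponents_exponent_sum[OF m] exponents_exponent_sum[OF w] by simp
    have mc: "Poly_Mapping.lookup m c \<ge> 1"
      using look[of c] cab ce_in by (simp add: lookup_edge_exponent)
    hence "d \<noteq> 0" using exponents_le[OF m, of c] by simp
    then obtain d0 where d0: "d = Suc d0" by (cases d) auto
    show "m \<in> Exp.multiples n (edge_exponents E'')"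
    proof (cases "Poly_Mapping.lookup m b \<le> d0")
      case True
      then obtain l m' where l: "l \<in> {1..n}" "l \<noteq> c" "l \<noteq> b" "m' \<in> exponents n d0" "m = edge_exponent c l + m'"
        using exponents_split_edge_avoiding[of m n d0 c b] m mc cab d0 by metis
      hence "{c, l} \<in> E''" using ce unfolding E''_def by blast
      thus ?thesis unfolding multiples_edge_iff using l by blast
    next
      case False
      hence mb: "Poly_Mapping.lookup m b = d" using exponents_le[OF m, of b] d0 by simp
      have "b = e"
      proof (rule ccontr)
        assume "b \<noteq> e"
        hence "Poly_Mapping.lookup w b = Suc d" using look[of b] cab ab_in mb by (simp add: lookup_edge_exponent)
        thus False using exponents_le[OF w, of b] dd by simp
      qed
      hence cb: "{c, b} \<in> E''" using ce ab_in cab unfolding E''_def by blast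
      have "Poly_Mapping.lookup m i \<le> d0" if i: "i \<noteq> c" "i \<noteq> b" for i
      proof -
        have "(\<Sum>j\<in>{i, c, b}. Poly_Mapping.lookup m j) \<le> 2 * d"
          using sum_lookup_le_exponent_sum[OF exponents_keys[OF m], of "{i, c, b}"] exponents_exponent_sum[OF m] by simp
        hence "Poly_Mapping.lookup m i + Poly_Mapping.lookup m c + Poly_Mapping.lookup m b \<le> 2 * d"
          using i cab by simp
        thus ?thesis using mb mc d0 by linarith
      qed
      then obtain m' where "m' \<in> exponents n d0" "m = edge_exponent c b + m'"
        using exponents_split_edge[of m n d0 c b] m d0 cab mc mb by auto
      thus ?thesis unfolding multiples_edge_iff using cb by blast
    qed
  qed
qed

section \<open>The edge ring as a standard graded algebra\<close>

lemma edge_monomial_eq: "edge_monomial i j = Poly_Mapping.single (edge_exponent i j) 1"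
  unfolding edge_monomial_def edge_exponent_def ..

text \<open>
The ambient monoid ring is left arbitrary, because the lemma is applied both inside the polynomial ring, to
identify the edge ring, and inside the edge ring, to see that it is generated in degree one.
\<close>

lemma supported_exponents_generated:
  fixes S :: "('k::field) mpoly set"
  assumes const: "constants \<subseteq> S"
    and edges: "\<And>i j. i \<in> {1..n} \<Longrightarrow> j \<in> {1..n} \<Longrightarrow> i \<noteq> j \<Longrightarrow> edge_monomial i j \<in> S"
  shows "supported (all_exponents n) \<subseteq> generate_ring (monoid_ring A) S"
proof
  fix p :: "'k mpoly" assume "p \<in> supported (all_exponents n)"
  thus "p \<in> generate_ring (monoid_ring A) S"
  proof (induction rule: supported_induct)
    case zero
    have "Poly_Mapping.single 0 0 \<in> S" using const unfolding constants_def by blast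
    thus ?case by (auto intro: generate_ring.incl)
  next
    case (add p q)
    thus ?case using generate_ring.eng_add[of p "monoid_ring A" S q] by simp
  next
    case (monomial m c)
    then obtain d where "m \<in> exponents n d" by blast
    thus ?case
    proof (induction d arbitrary: m)
      case 0
      hence "Poly_Mapping.single m c \<in> S" using const exponents_0 unfolding constants_def by auto
      thus ?case by (rule generate_ring.incl)
    next
      case (Suc d)
      obtain k l m' where kl: "k \<in> {1..n}" "l \<in> {1..n}" "k \<noteq> l" "m' \<in> exponents n d" "m = edge_exponent k l + m'"
        using exponents_Suc_edge[OF Suc.prems] by blast
      have "edge_monomial k l \<in> generate_ring (monoid_ring A) S"
        by (rule generate_ring.incl[OF edges[OF kl(1-3)]])
      moreover have "Poly_Mapping.single m' c \<in> generate_ring (monoid_ring A) S" by (rule Suc.IH[OF kl(4)])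
      ultimately have "edge_monomial k l * Poly_Mapping.single m' c \<in> generate_ring (monoid_ring A) S"
        using generate_ring.eng_mult[of "edge_monomial k l" "monoid_ring A" S "Poly_Mapping.single m' c"] by simp
      thus ?case unfolding edge_monomial_eq kl(5) by (simp add: mult_single)
    qed
  qed
qed

lemma constants_subset: "(constants :: ('k::field) mpoly set) \<subseteq> supported (all_exponents n)"
  unfolding constants_def using Exp.zero_exponent by (auto intro: supported_single)

text \<open>
The edge ring is the monoid ring of the degree sequences: every degree sequence is a sum of edges,
since edges can be split off one after the other.
\<close>

lemma edge_ring_eq: "edge_ring n = (monoid_ring (all_exponents n) :: ('k::field) mpoly ring)"
proof -
  define U where "U = {m :: nat \<Rightarrow>\<^sub>0 nat. Poly_Mapping.keys m \<subseteq> {1..n}}"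
  let ?S = "constants \<union> {edge_monomial i j | i j. i \<in> {1..n} \<and> j \<in> {1..n} \<and> i < j} :: 'k mpoly set"
  interpret U: exponent_monoid U
  proof
    show "a + b \<in> U" if "a \<in> U" "b \<in> U" for a b using keys_add[of a b] that unfolding U_def by blast
  qed (simp add: U_def)
  interpret cring "monoid_ring U :: 'k mpoly ring" by (rule U.cring_monoid_ring)
  have poly_ring: "poly_ring_upto n = (monoid_ring U :: 'k mpoly ring)"
    unfolding poly_ring_upto_def monoid_ring_def supported_def U_def by (simp add: subset_iff Ball_def)
  have sub: "supported (all_exponents n) \<subseteq> (supported U :: 'k mpoly set)"
    by (rule supported_mono) (use exponents_keys in \<open>auto simp: U_def\<close>)
  have edge: "edge_monomial i j \<in> (supported (all_exponents n) :: 'k mpoly set)"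
    if "i \<in> {1..n}" "j \<in> {1..n}" "i \<noteq> j" for i j
    unfolding edge_monomial_eq using edge_exponent_mem[OF that] by (intro supported_single) blast
  have S: "?S \<subseteq> supported (all_exponents n)" using constants_subset edge by fastforce
  have "subring (supported (all_exponents n)) (monoid_ring U :: 'k mpoly ring)"
  proof (rule subringI)
    fix x :: "'k mpoly" assume x: "x \<in> supported (all_exponents n)"
    thus "\<ominus>\<^bsub>monoid_ring U\<^esub> x \<in> supported (all_exponents n)"
      using U.monoid_ring_uminus[of x] sub by (auto simp: supported_uminus)
  next
    fix x y :: "'k mpoly" assume "x \<in> supported (all_exponents n)" "y \<in> supported (all_exponents n)"
    thus "x \<otimes>\<^bsub>monoid_ring U\<^esub> y \<in> supported (all_exponents n)"
      unfolding monoid_ring_simps by (rule supported_mult) (rule Exp.add_exponent)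
  qed (use sub in \<open>simp_all add: supported_add supported_one[OF Exp.zero_exponent]\<close>)
  moreover have "?S \<subseteq> carrier (monoid_ring U)"
    unfolding monoid_ring_simps using S sub by (rule subset_trans)
  ultimately have "generate_ring (monoid_ring U) ?S \<subseteq> supported (all_exponents n)"
    using S by (intro generate_ring_min_subring1)
  moreover have "supported (all_exponents n) \<subseteq> generate_ring (monoid_ring U) ?S"
  proof (rule supported_exponents_generated)
    fix i j assume ij: "i \<in> {1..n}" "j \<in> {1..n}" "i \<noteq> j"
    have "edge_monomial i j = edge_monomial j i" unfolding edge_monomial_eq edge_exponent_commute[of i] ..
    moreover have "i < j \<or> j < i" using ij(3) by linarith
    ultimately show "edge_monomial i j \<in> ?S" using ij(1,2) by (metis (mono_tags, lifting) UnI2 mem_Collect_eq)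
  qed simp
  ultimately have "generate_ring (poly_ring_upto n) ?S = supported (all_exponents n)"
    unfolding poly_ring by (rule equalityI)
  thus ?thesis unfolding edge_ring_def poly_ring by (simp add: monoid_ring_def)
qed

lemma edge_ring_grading_eq: "edge_ring_grading n d = (supported (exponents n d) :: ('k::field) mpoly set)"
proof -
  have exponent_sum: "(\<Sum>i\<in>Poly_Mapping.keys m. Poly_Mapping.lookup m i) = exponent_sum n m" if "Poly_Mapping.keys m \<subseteq> {1..n}" for m
    unfolding exponent_sum_def using that by (intro sum.mono_neutral_left) (auto simp: in_keys_iff)
  have iff: "m \<in> all_exponents n \<and> (\<Sum>i\<in>Poly_Mapping.keys m. Poly_Mapping.lookup m i) = 2 * d
    \<longleftrightarrow> m \<in> exponents n d" for m
  proof
    assume a: "m \<in> all_exponents n \<and> (\<Sum>i\<in>Poly_Mapping.keys m. Poly_Mapping.lookup m i) = 2 * d"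
    then obtain e where e: "m \<in> exponents n e" by blast
    hence "2 * e = 2 * d" using a exponent_sum[OF exponents_keys[OF e]] exponents_exponent_sum[OF e] by simp
    thus "m \<in> exponents n d" using e by simp
  next
    assume "m \<in> exponents n d"
    thus "m \<in> all_exponents n \<and> (\<Sum>i\<in>Poly_Mapping.keys m. Poly_Mapping.lookup m i) = 2 * d"
      using exponent_sum[OF exponents_keys] exponents_exponent_sum by (metis UN_I UNIV_I)
  qed
  show ?thesis
    unfolding edge_ring_grading_def edge_ring_eq monoid_ring_simps supported_def subset_iff Ball_def mem_Collect_eq
    using iff by (intro Collect_cong) metis
qed

definition homogeneous_part :: "nat \<Rightarrow> nat \<Rightarrow> ('k::zero) mpoly \<Rightarrow> 'k mpoly" where
  "homogeneous_part n d p = Poly_Mapping.mapp (\<lambda>m c. c when m \<in> exponents n d) p"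

lemma lookup_homogeneous_part:
  "Poly_Mapping.lookup (homogeneous_part n d p) m = (Poly_Mapping.lookup p m when m \<in> exponents n d)"
  unfolding homogeneous_part_def lookup_mapp by (auto simp: when_def in_keys_iff)

lemma exponents_disjoint: "m \<in> exponents n d \<Longrightarrow> m \<in> exponents n e \<Longrightarrow> d = e"
  using exponents_exponent_sum[of m n d] exponents_exponent_sum[of m n e] by simp

lemma finite_homogeneous_parts: "finite {d. homogeneous_part n d p \<noteq> 0}"
proof (rule finite_subset)
  show "{d. homogeneous_part n d p \<noteq> 0} \<subseteq> (\<lambda>m. exponent_sum n m div 2) ` Poly_Mapping.keys p"
  proof
    fix d assume "d \<in> {d. homogeneous_part n d p \<noteq> 0}"
    then obtain m where "Poly_Mapping.lookup (homogeneous_part n d p) m \<noteq> 0"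
      by (metis lookup_zero mem_Collect_eq poly_mapping_eqI)
    hence m: "m \<in> exponents n d" "m \<in> Poly_Mapping.keys p"
      unfolding lookup_homogeneous_part by (auto simp: in_keys_iff when_def split: if_splits)
    show "d \<in> (\<lambda>m. exponent_sum n m div 2) ` Poly_Mapping.keys p"
      using exponents_exponent_sum[OF m(1)] m(2) by (intro image_eqI[of _ _ m]) simp_all
  qed
qed simp

text \<open>
The sets \<open>exponents n d\<close> are disjoint for different \<open>d\<close>, so the coefficients of each summand can be read
off from the sum. This gives existence and uniqueness of the decomposition at once.
\<close>

lemma homogeneous_sum_iff:
  fixes p :: "('k::comm_monoid_add) mpoly"
  assumes p: "p \<in> supported (all_exponents n)"
    and f: "\<And>d. f d \<in> supported (exponents n d)" and fin: "finite {d. f d \<noteq> 0}"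
  shows "p = (\<Sum>d\<in>{d. f d \<noteq> 0}. f d) \<longleftrightarrow> f = (\<lambda>d. homogeneous_part n d p)"
proof -
  let ?s = "\<Sum>d\<in>{d. f d \<noteq> 0}. f d"
  have f0: "Poly_Mapping.lookup (f d) m = 0" if "m \<notin> exponents n d" for d m
    using f[of d] that unfolding supported_iff by blast
  have lookup: "Poly_Mapping.lookup ?s m = Poly_Mapping.lookup (f e) m" if e: "m \<in> exponents n e" for e m
  proof -
    have "Poly_Mapping.lookup (f d) m = (if d = e then Poly_Mapping.lookup (f e) m else 0)" for d
      using f0[of m d] exponents_disjoint[OF _ e] by auto
    hence "Poly_Mapping.lookup ?s m = (\<Sum>d\<in>{d. f d \<noteq> 0}. if d = e then Poly_Mapping.lookup (f e) m else 0)"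
      by (simp add: lookup_sum)
    also have "\<dots> = Poly_Mapping.lookup (f e) m" using fin by auto
    finally show ?thesis .
  qed
  show ?thesis
  proof
    assume eq: "p = ?s"
    show "f = (\<lambda>d. homogeneous_part n d p)"
    proof (rule ext, rule poly_mapping_eqI)
      fix d m
      show "Poly_Mapping.lookup (f d) m = Poly_Mapping.lookup (homogeneous_part n d p) m"
        unfolding lookup_homogeneous_part using lookup[of m d] f0[of m d] eq
        by (cases "m \<in> exponents n d") simp_all
    qed
  next
    assume eq: "f = (\<lambda>d. homogeneous_part n d p)"
    show "p = ?s"
    proof (rule poly_mapping_eqI)
      fix m
      show "Poly_Mapping.lookup p m = Poly_Mapping.lookup ?s m"
      proof (cases "m \<in> all_exponents n")
        case True
        then obtain e where e: "m \<in> exponents n e" by blast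
        show ?thesis unfolding lookup[OF e] unfolding eq lookup_homogeneous_part using e by simp
      next
        case False
        hence "Poly_Mapping.lookup p m = 0" using p unfolding supported_iff by blast
        moreover have "Poly_Mapping.lookup (f d) m = 0" for d using f0[of m d] False by blast
        ultimately show ?thesis by (simp add: lookup_sum)
      qed
    qed
  qed
qed

lemma edge_ring_decomposition:
  fixes x :: "('k::field) mpoly"
  assumes x: "x \<in> supported (all_exponents n)"
  shows "\<exists>!f. (\<forall>d. f d \<in> supported (exponents n d)) \<and> finite {d. f d \<noteq> 0}
      \<and> x = (\<Oplus>\<^bsub>monoid_ring (all_exponents n)\<^esub> d\<in>{d. f d \<noteq> 0}. f d)"
proof -
  have part: "homogeneous_part n d x \<in> supported (exponents n d)" for d
    unfolding supported_iff lookup_homogeneous_part by simp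
  have iff: "x = (\<Oplus>\<^bsub>monoid_ring (all_exponents n)\<^esub> d\<in>{d. f d \<noteq> 0}. f d)
      \<longleftrightarrow> f = (\<lambda>d. homogeneous_part n d x)"
    if f: "\<forall>d. f d \<in> supported (exponents n d)" "finite {d. f d \<noteq> 0}" for f :: "nat \<Rightarrow> 'k mpoly"
  proof -
    have "f d \<in> supported (all_exponents n)" for d
      using f(1) supported_mono[of "exponents n d" "all_exponents n"] by blast
    hence "(\<Oplus>\<^bsub>monoid_ring (all_exponents n)\<^esub> d\<in>{d. f d \<noteq> 0}. f d) = (\<Sum>d\<in>{d. f d \<noteq> 0}. f d)"
      by (intro Exp.monoid_ring_finsum[OF f(2)])
    thus ?thesis using homogeneous_sum_iff[OF x _ f(2)] f(1) by simp
  qed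
  show ?thesis
  proof (rule ex1I)
    show "(\<forall>d. homogeneous_part n d x \<in> supported (exponents n d)) \<and> finite {d. homogeneous_part n d x \<noteq> 0}
      \<and> x = (\<Oplus>\<^bsub>monoid_ring (all_exponents n)\<^esub> d\<in>{d. homogeneous_part n d x \<noteq> 0}. homogeneous_part n d x)"
      using iff[of "\<lambda>d. homogeneous_part n d x"] part finite_homogeneous_parts[of n x] by blast
  next
    fix f :: "nat \<Rightarrow> 'k mpoly"
    assume "(\<forall>d. f d \<in> supported (exponents n d)) \<and> finite {d. f d \<noteq> 0}
      \<and> x = (\<Oplus>\<^bsub>monoid_ring (all_exponents n)\<^esub> d\<in>{d. f d \<noteq> 0}. f d)"
    thus "f = (\<lambda>d. homogeneous_part n d x)" using iff[of f] by blast
  qed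
qed

lemma constants_eq: "constants = (supported {0} :: ('k::field) mpoly set)"
proof
  show "constants \<subseteq> (supported {0} :: 'k mpoly set)" unfolding constants_def by (auto intro: supported_single)
  show "(supported {0} :: 'k mpoly set) \<subseteq> constants"
  proof
    fix p :: "'k mpoly" assume "p \<in> supported {0}"
    hence "p = Poly_Mapping.single 0 (Poly_Mapping.lookup p 0)"
      unfolding supported_iff by (intro poly_mapping_eqI) (auto simp: lookup_single when_def)
    thus "p \<in> constants" unfolding constants_def by blast
  qed
qed

lemma exponents_subalgebra:
  "subalgebra constants (supported (exponents n d)) (monoid_ring (all_exponents n) :: ('k::field) mpoly ring)"
proof (intro subalgebra.intro subalgebra_axioms.intro)
  show "subgroup (supported (exponents n d)) (add_monoid (monoid_ring (all_exponents n) :: 'k mpoly ring))"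
    by (rule Exp.supported_subgroup) blast
  fix k v :: "'k mpoly" assume "k \<in> constants" and v: "v \<in> supported (exponents n d)"
  hence "k \<in> supported {0}" unfolding constants_eq by simp
  thus "k \<otimes>\<^bsub>monoid_ring (all_exponents n)\<^esub> v \<in> supported (exponents n d)"
    unfolding monoid_ring_simps using v by (rule supported_mult) simp
qed

lemma linear_forms_finite_dimension:
  "ring.finite_dimension (monoid_ring (all_exponents n)) constants (supported (exponents n 1) :: ('k::field) mpoly set)"
proof -
  let ?R = "monoid_ring (all_exponents n) :: 'k mpoly ring"
  interpret cring ?R by (rule Exp.cring_monoid_ring)
  have K: "subfield constants ?R" unfolding constants_def by (rule Exp.constants_subfield)
  let ?B = "(\<lambda>(i, j). edge_monomial i j :: 'k mpoly) ` {(i, j). i \<in> {1..n} \<and> j \<in> {1..n} \<and> i \<noteq> j}"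
  have "{(i, j). i \<in> {1..n} \<and> j \<in> {1..n} \<and> i \<noteq> j} \<subseteq> {1..n} \<times> {1..n}" by blast
  hence "finite ?B" by (meson finite_SigmaI finite_atLeastAtMost finite_imageI finite_subset)
  then obtain Us where Us: "set Us = ?B" using finite_list by blast
  have B: "?B \<subseteq> supported (exponents n 1)"
    unfolding edge_monomial_eq using edge_exponent_mem by (auto intro!: supported_single)
  have sub: "supported (exponents n d) \<subseteq> (supported (all_exponents n) :: 'k mpoly set)" for d
    by (rule supported_mono) blast
  have UsR: "set Us \<subseteq> carrier ?R" using Us B sub[of 1] by simp
  have "Span constants Us \<subseteq> supported (exponents n 1)"
    using B Us by (intro subalgebra_Span_incl[OF K exponents_subalgebra]) simp
  moreover have "supported (exponents n 1) \<subseteq> Span constants Us"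
  proof
    fix p :: "'k mpoly" assume "p \<in> supported (exponents n 1)"
    thus "p \<in> Span constants Us"
    proof (induction rule: supported_induct)
      case zero show ?case using Span_subgroup_props(2)[OF K UsR] by simp
    next
      case (add p q) thus ?case using Span_subgroup_props(3)[OF K UsR, of p q] by simp
    next
      case (monomial m c)
      then obtain k l m' where kl: "k \<in> {1..n}" "l \<in> {1..n}" "k \<noteq> l" "m' \<in> exponents n 0" "m = edge_exponent k l + m'"
        using exponents_Suc_edge[of m n 0] by auto
      hence "edge_monomial k l \<in> set Us" unfolding Us by blast
      hence "edge_monomial k l \<in> Span constants Us" using Span_base_incl[OF K UsR] by blast
      moreover have "Poly_Mapping.single 0 c \<in> constants" unfolding constants_def by blast
      ultimately have "Poly_Mapping.single 0 c * edge_monomial k l \<in> Span constants Us"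
        using Span_smult_closed[OF K UsR, of "Poly_Mapping.single 0 c" "edge_monomial k l"] by simp
      thus ?case using kl exponents_0 unfolding edge_monomial_eq by (simp add: mult_single)
    qed
  qed
  ultimately have "supported (exponents n 1) = Span constants Us" by blast
  thus ?thesis using Span_finite_dimension[OF K UsR] by simp
qed

lemma edge_ring_standard_graded:
  "standard_graded_algebra (constants :: ('k::field) mpoly set) (edge_ring n) (edge_ring_grading n)"
proof -
  let ?R = "monoid_ring (all_exponents n) :: 'k mpoly ring"
  interpret cring ?R by (rule Exp.cring_monoid_ring)
  interpret K: subfield constants ?R unfolding constants_def by (rule Exp.constants_subfield)
  have sub: "supported (exponents n d) \<subseteq> (supported (all_exponents n) :: 'k mpoly set)" for d
    by (rule supported_mono) blast
  have gen: "generate_ring ?R (constants \<union> supported (exponents n 1)) = carrier ?R"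
  proof
    show "generate_ring ?R (constants \<union> supported (exponents n 1)) \<subseteq> carrier ?R"
      using constants_subset sub[of 1] by (intro generate_ring_incl) simp
    show "carrier ?R \<subseteq> generate_ring ?R (constants \<union> supported (exponents n 1))"
      unfolding monoid_ring_simps
    proof (rule supported_exponents_generated)
      show "edge_monomial i j \<in> constants \<union> supported (exponents n 1)"
        if "i \<in> {1..n}" "j \<in> {1..n}" "i \<noteq> j" for i j
        unfolding edge_monomial_eq using supported_single[OF edge_exponent_mem[OF that]] by blast
    qed simp
  qed
  show ?thesis
    unfolding edge_ring_eq edge_ring_grading_eq
  proof (intro standard_graded_algebra.intro standard_graded_algebra_axioms.intro embedded_algebra.intro)
    fix d
    show "subalgebra constants (supported (exponents n d)) ?R" by (rule exponents_subalgebra)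
  next
    fix x assume "x \<in> carrier ?R"
    thus "\<exists>!f. (\<forall>d. f d \<in> supported (exponents n d)) \<and> finite {d. f d \<noteq> \<zero>\<^bsub>?R\<^esub>}
      \<and> x = (\<Oplus>\<^bsub>?R\<^esub> d\<in>{d. f d \<noteq> \<zero>\<^bsub>?R\<^esub>}. f d)"
      unfolding monoid_ring_simps by (rule edge_ring_decomposition)
  next
    fix x y :: "'k mpoly" and c d assume "x \<in> supported (exponents n c)" "y \<in> supported (exponents n d)"
    thus "x \<otimes>\<^bsub>?R\<^esub> y \<in> supported (exponents n (c + d))"
      unfolding monoid_ring_simps by (rule supported_mult) (rule exponents_add)
  next
    show "supported (exponents n 0) = (constants :: 'k mpoly set)" unfolding constants_eq exponents_0 ..
  qed (fact K.subfield_axioms ring_axioms cring_axioms linear_forms_finite_dimension gen)+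
qed

section \<open>The edge ideals of split graphs form a Koszul filtration\<close>

lemma edge_ideal_eq:
  assumes "snd H \<subseteq> snd (complete_graph n)"
  shows "edge_ideal n H = (supported (Exp.multiples n (edge_exponents (snd H))) :: ('k::field) mpoly set)"
proof -
  have "{edge_monomial i j | i j. {i, j} \<in> snd H}
      = ((\<lambda>s. Poly_Mapping.single s 1) ` edge_exponents (snd H) :: 'k mpoly set)"
    unfolding edge_monomial_eq edge_exponents_def by blast
  moreover have "edge_exponents (snd H) \<subseteq> all_exponents n" using edge_exponents_subset[OF assms] by blast
  ultimately show ?thesis unfolding edge_ideal_def edge_ring_eq by (simp add: Exp.monomial_ideal)
qed

text \<open>
Edge ideals depend on the edge set only, so by the characterisation of the graph family by split graphs
they can be indexed by split edge sets.
\<close>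

lemma edge_ideals_eq:
  "{edge_ideal n H | H. H \<in> graph_family n}
   = {supported (Exp.multiples n (edge_exponents E)) :: ('k::field) mpoly set | E C.
       E \<subseteq> snd (complete_graph n) \<and> split_by C E}" (is "?L = ?R")
proof (intro equalityI subsetI)
  fix I assume "I \<in> ?L"
  then obtain H where H: "I = edge_ideal n H" "H \<in> graph_family n" by blast
  obtain C where "split_by C (snd H)" using graph_family_imp_split[OF H(2)] by blast
  moreover have sub: "snd H \<subseteq> snd (complete_graph n)"
    using H(2) unfolding graph_family_def subgraph_def by blast
  ultimately show "I \<in> ?R" using H(1) edge_ideal_eq[OF sub] by blast
next
  fix I :: "'k mpoly set" assume "I \<in> ?R"
  then obtain E C where E: "I = supported (Exp.multiples n (edge_exponents E))"
    "E \<subseteq> snd (complete_graph n)" "split_by C E" by blast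
  have "I = edge_ideal n (\<Union>E, E)" using E(1,2) edge_ideal_eq[of "(\<Union>E, E)" n, where 'k = 'k] by simp
  thus "I \<in> ?L" using split_imp_graph_family[OF E(2,3)] by blast
qed

text \<open>
Every exponent vector of positive degree splits off an edge, so the edges of the complete graph already
generate the graded maximal ideal.
\<close>

lemma positive_degree_ideal:
  "Idl\<^bsub>monoid_ring (all_exponents n)\<^esub> (\<Union>d\<in>{1..}. supported (exponents n d))
    = (supported (Exp.multiples n (edge_exponents (snd (complete_graph n)))) :: ('k::field) mpoly set)"
proof -
  let ?R = "monoid_ring (all_exponents n) :: 'k mpoly ring"
  let ?K = "edge_exponents (snd (complete_graph n))"
  let ?G = "\<Union>d\<in>{1..}. supported (exponents n d) :: 'k mpoly set"
  interpret cring ?R by (rule Exp.cring_monoid_ring)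
  have G: "?G \<subseteq> carrier ?R" unfolding supported_def monoid_ring_simps by blast
  have K1: "?K \<subseteq> exponents n 1" by (rule edge_exponents_subset) simp
  hence K: "?K \<subseteq> all_exponents n" by blast
  have "ideal (supported (Exp.multiples n ?K)) ?R"
    by (rule Exp.supported_ideal[OF Exp.multiples_subset[OF K] Exp.multiples_absorb])
  moreover have "?G \<subseteq> supported (Exp.multiples n ?K)"
  proof -
    have "exponents n d \<subseteq> Exp.multiples n ?K" if "d \<in> {1..}" for d
    proof
      fix m assume m: "m \<in> exponents n d"
      obtain e where "d = Suc e" using \<open>d \<in> {1..}\<close> by (cases d) auto
      then obtain k l m' where "k \<in> {1..n}" "l \<in> {1..n}" "k \<noteq> l" "m' \<in> exponents n e"
        "m = edge_exponent k l + m'"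
        using exponents_Suc_edge m by metis
      thus "m \<in> Exp.multiples n ?K"
        unfolding multiples_edge_iff using complete_graph_edge_iff by blast
    qed
    thus ?thesis using supported_mono by blast
  qed
  ultimately have "Idl\<^bsub>?R\<^esub> ?G \<subseteq> supported (Exp.multiples n ?K)" by (rule genideal_minimal)
  moreover have "supported (Exp.multiples n ?K) \<subseteq> Idl\<^bsub>?R\<^esub> ?G"
    unfolding Exp.monomial_ideal[OF K, symmetric]
  proof (rule genideal_minimal[OF genideal_ideal[OF G]])
    have "(\<lambda>s. Poly_Mapping.single s 1) ` ?K \<subseteq> ?G"
      using K1 by (auto intro!: supported_single)
    thus "(\<lambda>s. Poly_Mapping.single s 1) ` ?K \<subseteq> Idl\<^bsub>?R\<^esub> ?G"
      using genideal_self[OF G] by (rule subset_trans)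
  qed
  ultimately show ?thesis by (rule equalityI)
qed

theorem theorem2p2:
  fixes n :: nat
  shows "koszul_filtration (constants :: ('k::field) mpoly set) (edge_ring n) (edge_ring_grading n)
           {edge_ideal n H | H. H \<in> graph_family n}"
proof -
  let ?R = "monoid_ring (all_exponents n) :: 'k mpoly ring"
  let ?I = "\<lambda>E. supported (Exp.multiples n (edge_exponents E)) :: 'k mpoly set"
  let ?F = "{?I E | E C. E \<subseteq> snd (complete_graph n) \<and> split_by C E}"
  interpret cring ?R by (rule Exp.cring_monoid_ring)
  have sga: "standard_graded_algebra constants ?R (\<lambda>d. supported (exponents n d))"
    using edge_ring_standard_graded unfolding edge_ring_eq edge_ring_grading_eq .
  have gens: "?I E = Idl\<^bsub>?R\<^esub> ((\<lambda>s. Poly_Mapping.single s 1) ` edge_exponents E)"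
    if "E \<subseteq> snd (complete_graph n)" for E
    using edge_exponents_subset[OF that] by (intro Exp.monomial_ideal[symmetric]) blast
  have linear: "(\<lambda>s. Poly_Mapping.single s 1) ` edge_exponents E \<subseteq> (supported (exponents n 1) :: 'k mpoly set)"
    if "E \<subseteq> snd (complete_graph n)" for E
    using edge_exponents_subset[OF that] by (auto intro!: supported_single)
  have empty: "?I {} = {0}"
    unfolding Exp.multiples_def edge_exponents_def supported_def by auto
  have "koszul_filtration constants ?R (\<lambda>d. supported (exponents n d)) ?F"
  proof (intro koszul_filtration.intro koszul_filtration_axioms.intro sga)
    fix I assume "I \<in> ?F"
    thus "\<exists>S. S \<subseteq> supported (exponents n 1) \<and> I = Idl\<^bsub>?R\<^esub> S" using gens linear by blast
  next
    have "split_by {} ({} :: nat set set)" unfolding split_by_def by simp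
    thus "{\<zero>\<^bsub>?R\<^esub>} \<in> ?F" using empty by (metis (mono_tags, lifting) empty_subsetI mem_Collect_eq monoid_ring_simps(4))
  next
    let ?K = "snd (complete_graph n)" and ?G = "\<Union>d\<in>{1..}. supported (exponents n d) :: 'k mpoly set"
    have "Idl\<^bsub>?R\<^esub> ?G = ?I ?K" by (rule positive_degree_ideal)
    moreover have "split_by {1..n} ?K" by (rule split_by_complete_graph)
    ultimately show "standard_graded_algebra.graded_maximal_ideal ?R (\<lambda>d. supported (exponents n d)) \<in> ?F"
      unfolding standard_graded_algebra.graded_maximal_ideal_def[OF sga] by blast
  next
    fix I assume "I \<in> ?F" and I0: "I \<noteq> {\<zero>\<^bsub>?R\<^esub>}"
    then obtain E C where E: "I = ?I E" "E \<subseteq> snd (complete_graph n)" "split_by C E" by blast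
    have "E \<noteq> {}" using E(1) I0 empty by auto
    then obtain D a b where ab: "split_by D E" "a \<in> D" "b \<notin> D" "{a, b} \<in> E"
      using split_crossing_edge[OF E(2) _ E(3)] by blast
    let ?E = "E - {{a, b}}" and ?e = "edge_exponent a b"
    have sub: "?E \<subseteq> snd (complete_graph n)" using E(2) by blast
    have S: "edge_exponents ?E \<subseteq> all_exponents n" using edge_exponents_subset[OF sub] by blast
    have e: "?e \<in> all_exponents n"
      using edge_exponents_subset[OF E(2)] ab(4) unfolding edge_exponents_def by blast
    have ins: "edge_exponents E = insert ?e (edge_exponents ?E)"
      using edge_exponents_insert[of a b ?E] ab(4) by (simp add: insert_absorb)
    have split: "split_by D ?E" by (rule split_by_delete_edge[OF ab(1,3)])
    \<comment> \<open>Degrees leave only a constant cofactor, and distinct edges have distinct exponents.\<close>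
    have notin: "?e \<notin> Exp.multiples n (edge_exponents ?E)"
    proof
      assume "?e \<in> Exp.multiples n (edge_exponents ?E)"
      then obtain i j d m where ij: "m \<in> exponents n d" "{i, j} \<in> ?E" "?e = edge_exponent i j + m"
        unfolding multiples_edge_iff by blast
      have "a \<in> {1..n}" "b \<in> {1..n}" "i \<in> {1..n}" "j \<in> {1..n}"
        using complete_graph_edge_iff E(2) ab(4) ij(2) by blast+
      hence "2 = 2 + exponent_sum n m" using ij(3) exponent_sum_add exponent_sum_edge_exponent by metis
      hence "d = 0" using exponents_exponent_sum[OF ij(1)] by simp
      hence "m = 0" using ij(1) exponents_0 by simp
      hence "{a, b} = {i, j}" using ij(3) edge_exponent_eq_iff by simp
      thus False using ij(2) by simp
    qed
    have "?I ?E \<subset> I"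
    proof (rule psubsetI)
      show "?I ?E \<subseteq> I" unfolding E(1) ins Exp.multiples_def by (rule supported_mono) blast
      have "Poly_Mapping.single ?e 1 \<in> I"
        unfolding E(1) ins by (rule supported_single[OF Exp.multiples_self]) simp
      moreover have "Poly_Mapping.single ?e 1 \<notin> ?I ?E"
        using notin unfolding supported_def by simp
      ultimately show "?I ?E \<noteq> I" by blast
    qed
    moreover have "?I ?E \<in> ?F" using sub split by blast
    moreover have "cyclic_module ?R (quotient_module ?R I (?I ?E))"
      unfolding E(1) ins by (rule Exp.monomial_ideal_step(1)[OF S e])
    moreover have "module_annihilator ?R (quotient_module ?R I (?I ?E)) \<in> ?F"
    proof -
      note colon = split_colon[OF E(2) ab(1,4,2,3)]
      show ?thesis
        unfolding E(1) ins Exp.monomial_ideal_step(2)[OF S e] colon(3) using colon(1,2) by blast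
    qed
    ultimately show "\<exists>J\<in>?F. J \<subset> I \<and> cyclic_module ?R (quotient_module ?R I J)
        \<and> module_annihilator ?R (quotient_module ?R I J) \<in> ?F" by blast
  qed
  thus ?thesis unfolding edge_ring_eq edge_ring_grading_eq edge_ideals_eq .
qed

end
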